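(* Let $n,k,\Delta_*,m$ be positive integers. Define $$\psi_k=\begin{cases}\dfrac1m\left(\Delta_*^3+\log^9 n\right), & k=3,\\[2mm] \dfrac{k^2}{m}\left(\Delta_*^2+k\Delta_*\log^4 n+k^2\log^9 n\right), & k\ge4,\end{cases}$$ and assume $\psi_k<1$. Then, uniformly for all sequences $\mathbf{d}\in\mathbb{Z}^n$ with $\sum_{v\in[n]}d_v=km$ and $\Delta(\mathbf{d})\le\Delta_*$, $$\Pr_{\mathcal{D}_k(n,m)}(\mathbf{d})=\Pr_{\mathcal{B}_k(n,m)}(\mathbf{d})\exp\!\left(\frac{k-1}{2}\left(1-\frac{n\,\sigma^2(\mathbf{d})}{km}\right)\right)\left(1+O(\sqrt{\psi_k})\right).$$
   Context: A $k$-graph on $V=[n]$ is a set of $k$-element subsets of $V$; degrees and degree sequences are as usual. $\mathcal{D}_k(n,m)$ is the distribution of the degree sequence of a uniformly random $k$-graph on $[n]$ with $m$ edges. $\mathcal{B}_k(n,m)$ is the distribution on $\{\mathbf{d}\in\mathbb{Z}^n:\sum_v d_v=km\}$ given by $\Pr_{\mathcal{B}_k(n,m)}(\mathbf{d})=\binom{n\binom{n-1}{k-1}}{km}^{-1}\prod_{v\in[n]}\binom{\binom{n-1}{k-1}}{d_v}$. $\Delta(\mathbf{d})=\max_v d_v$, and $\sigma^2(\mathbf{d})=\frac1n\sum_v(d_v-d)^2$ where $d=km/n$ is the average. Asymptotics are as $n\to\infty$ with $k,m,\Delta_*$ possibly depending on $n$; "uniformly" means the implicit constant in the $O(\cdot)$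 does not depend on $\mathbf{d}$ or the parameters. *)

theory Defs
  imports Complex_Main
begin

definition kgraphs :: "nat \<Rightarrow> nat \<Rightarrow> nat \<Rightarrow> nat set set set" where
  "kgraphs n k m = {E. E \<subseteq> {e. e \<subseteq> {1..n} \<and> card e = k} \<and> card E = m}"

definition deg :: "nat set set \<Rightarrow> nat \<Rightarrow> nat" where
  "deg E v = card {e \<in> E. v \<in> e}"

definition has_degseq :: "nat \<Rightarrow> nat set set \<Rightarrow> (nat \<Rightarrow> int) \<Rightarrow> bool" where
  "has_degseq n E d \<longleftrightarrow> (\<forall>v \<in> {1..n}. int (deg E v) = d v)"

definition prob_D :: "nat \<Rightarrow> nat \<Rightarrow> nat \<Rightarrow> (nat \<Rightarrow> int) \<Rightarrow> real" where
  "prob_D n k m d =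
     real (card {E \<in> kgraphs n k m. has_degseq n E d}) / real (card (kgraphs n k m))"

definition ibinom :: "nat \<Rightarrow> int \<Rightarrow> nat" where
  "ibinom N x = (if x < 0 then 0 else N choose nat x)"

text \<open>Probability of d under B_k(n,m), for d with sum km.\<close>

definition prob_B :: "nat \<Rightarrow> nat \<Rightarrow> nat \<Rightarrow> (nat \<Rightarrow> int) \<Rightarrow> real" where
  "prob_B n k m d =
     (let N = (n - 1) choose (k - 1) in
       (\<Prod>v\<in>{1..n}. real (ibinom N (d v))) / real ((n * N) choose (k * m)))"

definition maxdeg :: "nat \<Rightarrow> (nat \<Rightarrow> int) \<Rightarrow> int" where
  "maxdeg n d = Max (d ` {1..n})"

definition sigma2 :: "nat \<Rightarrow> nat \<Rightarrow> nat \<Rightarrow> (nat \<Rightarrow> int) \<Rightarrow> real" where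
  "sigma2 n k m d = (1 / real n) * (\<Sum>v\<in>{1..n}. (real_of_int (d v) - real (k * m) / real n) ^ 2)"

definition psi :: "nat \<Rightarrow> nat \<Rightarrow> nat \<Rightarrow> nat \<Rightarrow> real" where
  "psi n k Ds m =
    (if k = 3 then (1 / real m) * (real Ds ^ 3 + ln (real n) ^ 9)
     else (real k ^ 2 / real m) *
            (real Ds ^ 2 + real k * real Ds * ln (real n) ^ 4 + real k ^ 2 * ln (real n) ^ 9))"

end

theory Submission
  imports Defs "HOL-Combinatorics.Multiset_Permutations"
begin

text \<open>The hypergraphs with degree sequence \<open>d\<close> are counted in the configuration model: a uniformly
  random permutation \<open>p\<close> assigns to each of the \<open>km\<close> slots (\<open>m\<close> edges with \<open>k\<close> slots each) one of the
  \<open>km\<close> points (\<open>d v\<close> points at each vertex \<open>v\<close>). Everything reduces to showing that \<open>p\<close> yields no edge with a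
  repeated vertex and no repeated edge with probability \<open>exp (- \<lambda>) (1 + O(\<psi>))\<close>, where
  \<open>\<lambda> = (k - 1) (\<Sum>v. d v (d v - 1)) / (2 k m)\<close>; the remaining factors are estimates of falling factorials.

  A loop is an event ``\<open>p a = u\<close> and \<open>p b = v\<close>'' with \<open>a, b\<close> in one edge and \<open>u, v\<close> at one vertex.
  Although \<open>exp (- \<lambda>)\<close> may be exponentially small, the probability of avoiding all loops is determined up to a
  factor \<open>exp (O(k \<Delta>\<^sup>2 / m))\<close>. From below this is the lopsided Lovasz local lemma: two such events either
  contradict each other (they \<^emph>\<open>conflict\<close>) or an event is negatively correlated with the avoidance of those
  it does not conflict with. From above one reveals the loops one at a time, and a switching argument shows that
  the avoidance of non-conflicting loops decreases the probability of a loop by a factor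
  \<open>1 - O(\<Delta> / m)\<close> only. Repeated edges are excluded by a union bound over three (\<open>k = 3\<close>) or four common
  vertices; the local lemma bounds these probabilities conditionally on the absence of loops.\<close>

section \<open>The local lemma for random permutations\<close>

definition agree :: "'a set \<Rightarrow> ('a \<times> 'a) set \<Rightarrow> ('a \<Rightarrow> 'a) set" where
  "agree U e = {p. p permutes U \<and> (\<forall>(a, u) \<in> e. p a = u)}"

definition avoid :: "'a set \<Rightarrow> ('a \<times> 'a) set set \<Rightarrow> ('a \<Rightarrow> 'a) set" where
  "avoid U J = {p. p permutes U} - \<Union> (agree U ` J)"

text \<open>Conflicting sets never lie in the graph of one permutation, since a slot would have two
  values or a value two slots. This relation replaces stochastic dependence in the local lemma:
  prescriptions on different slots and values may still be dependent in a random permutation, but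
  only in the harmless direction.\<close>

definition conflict :: "('a \<times> 'a) set \<Rightarrow> ('a \<times> 'a) set \<Rightarrow> bool" where
  "conflict e b \<longleftrightarrow> (\<exists>(a, u) \<in> e. \<exists>(a', u') \<in> b. (a = a') \<noteq> (u = u'))"

section \<open>Elementary facts about prescribed and avoided assignments\<close>

lemma agreeD: "p \<in> agree U e \<Longrightarrow> (a, u) \<in> e \<Longrightarrow> p a = u"
  by (auto simp: agree_def)

lemma agree_permutes: "p \<in> agree U e \<Longrightarrow> p permutes U"
  by (simp add: agree_def)

lemma avoid_permutes: "p \<in> avoid U J \<Longrightarrow> p permutes U"
  by (simp add: avoid_def)

lemma finite_agree [simp]: "finite U \<Longrightarrow> finite (agree U e)"
  by (rule finite_subset[OF _ finite_permutations[of U]]) (auto simp: agree_def)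

lemma finite_avoid [simp]: "finite U \<Longrightarrow> finite (avoid U J)"
  by (rule finite_subset[OF _ finite_permutations[of U]]) (auto simp: avoid_def)

lemma avoid_antimono: "J \<subseteq> J' \<Longrightarrow> avoid U J' \<subseteq> avoid U J"
  by (auto simp: avoid_def)

lemma agree_conflict: "conflict e b \<Longrightarrow> agree U e \<inter> agree U b = {}"
proof (rule ccontr)
  assume "conflict e b" and "agree U e \<inter> agree U b \<noteq> {}"
  then obtain p a u a' u' where "p permutes U" "p a = u" "p a' = u'" "(a = a') \<noteq> (u = u')"
    unfolding conflict_def by (blast dest: agreeD agree_permutes)
  then show False using permutes_inj[of p U] by (auto simp: inj_eq)
qed

lemma conflict_mono: "conflict e b \<Longrightarrow> e \<subseteq> e' \<Longrightarrow> conflict e' b"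
  unfolding conflict_def by blast

text \<open>A switching argument. Exchanging the values \<open>u\<close> and \<open>u'\<close> after
  \<open>p\<close> maps the permutations with \<open>a \<mapsto> u\<close> injectively to those with
  \<open>a \<mapsto> u'\<close>. It cannot bring about an event of \<open>J\<close>: such an event,
  being free of conflict with \<open>(a, u)\<close>, would already hold for \<open>p\<close>. At
  least \<open>card U - card e\<close> values \<open>u'\<close> are available.\<close>

lemma card_agree_insert_avoid_le:
  assumes U: "finite U" and e: "finite e" and au: "a \<in> U" "u \<in> U" "a \<notin> fst ` e" "u \<notin> snd ` e"
    and J: "\<And>b. b \<in> J \<Longrightarrow> \<not> conflict {(a, u)} b"
  shows "(card U - card e) * card (agree U (insert (a, u) e) \<inter> avoid U J)
           \<le> card (agree U e \<inter> avoid U J)"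
proof -
  let ?S = "agree U (insert (a, u) e) \<inter> avoid U J"
  define T where "T u' = {p \<in> agree U e \<inter> avoid U J. p a = u'}" for u'
  have le: "card ?S \<le> card (T u')" if u': "u' \<in> U - snd ` e" for u'
  proof (rule card_inj_on_le[where f = "\<lambda>p. transpose u u' \<circ> p"])
    show "inj_on (\<lambda>p. transpose u u' \<circ> p) ?S"
      by (rule inj_onI) (metis (no_types, opaque_lifting) comp_assoc id_comp transpose_comp_involutory)
    show "finite (T u')" using U by (auto simp: T_def)
    show "(\<lambda>p. transpose u u' \<circ> p) ` ?S \<subseteq> T u'"
    proof (rule image_subsetI)
      fix p assume p: "p \<in> ?S"
      let ?q = "transpose u u' \<circ> p"
      have pU: "p permutes U" and pau: "p a = u" using p by (auto simp: agree_def)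
      have inj: "inj p" using pU permutes_inj by blast
      have qU: "?q permutes U"
        using pU u' au by (intro permutes_compose permutes_swap_id) auto
      have qe: "?q \<in> agree U e"
      proof -
        have "?q b = v" if "(b, v) \<in> e" for b v
        proof -
          have "p b = v" using p that by (auto simp: agree_def)
          moreover have "v \<noteq> u" "v \<noteq> u'" using that au u' by force+
          ultimately show ?thesis by (simp add: transpose_def)
        qed
        then show ?thesis using qU by (auto simp: agree_def)
      qed
      have "?q \<in> avoid U J"
      proof (rule ccontr)
        assume "?q \<notin> avoid U J"
        then obtain b where b: "b \<in> J" "?q \<in> agree U b" using qU by (auto simp: avoid_def)
        have "p \<in> agree U b"
        proof -
          have "p z = v" if zv: "(z, v) \<in> b" for z v
          proof -
            have q: "?q z = v" using b zv by (auto simp: agree_def)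
            \<comment> \<open>Either \<open>(z, v)\<close> is \<open>(a, u)\<close>, or
              \<open>z\<close> differs from \<open>a\<close> and \<open>v\<close> from
              \<open>u\<close>; in the second case the exchange does not touch the value of
              \<open>z\<close>.\<close>
            have nc: "(a = z) = (u = v)" using J[OF b(1)] zv by (auto simp: conflict_def)
            show ?thesis
            proof (cases "z = a")
              case True then show ?thesis using nc pau by auto
            next
              case False
              then have "p z \<noteq> u" "v \<noteq> u" using inj pau nc by (auto simp: inj_eq)
              then show ?thesis using q by (auto simp: transpose_def split: if_splits)
            qed
          qed
          then show ?thesis using pU by (auto simp: agree_def)
        qed
        then show False using p b by (auto simp: avoid_def)
      qed
      then show "?q \<in> T u'" using qe pau by (auto simp: T_def)
    qed
  qed
  have "(card U - card e) * card ?S \<le> card (U - snd ` e) * card ?S"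
    using diff_card_le_card_Diff[of "snd ` e" U] card_image_le[OF e, of snd] e
    by (intro mult_right_mono) auto
  also have "\<dots> = (\<Sum>u'\<in>U - snd ` e. card ?S)" by simp
  also have "\<dots> \<le> (\<Sum>u'\<in>U - snd ` e. card (T u'))" using le by (intro sum_mono) auto
  also have "\<dots> = card (\<Union>u'\<in>U - snd ` e. T u')"
    using U by (intro card_UN_disjoint[symmetric]) (auto simp: T_def)
  also have "\<dots> \<le> card (agree U e \<inter> avoid U J)"
    using U by (intro card_mono) (auto simp: T_def)
  finally show ?thesis .
qed

text \<open>Negative correlation: given the avoidance of \<open>J\<close>, the event of
  \<open>e\<close> is at most as likely as a consistent prescription of \<open>card e\<close> values
  without this condition. The pairs are added one at a time, each costing one factor of the
  product.\<close>

lemma card_agree_avoid_le: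
  assumes U: "finite U" and e: "finite e" "e \<subseteq> U \<times> U"
    and J: "\<And>b. b \<in> J \<Longrightarrow> \<not> conflict e b"
  shows "(\<Prod>i<card e. card U - i) * card (agree U e \<inter> avoid U J) \<le> card (avoid U J)"
  using e J
proof (induction e)
  case empty
  then show ?case using U by (auto intro: card_mono)
next
  case (insert x e)
  obtain a u where x: "x = (a, u)" by fastforce
  show ?case
  proof (cases "agree U (insert x e) \<inter> avoid U J = {}")
    case False
    \<comment> \<open>A permutation in the intersection guarantees that \<open>a\<close> and
      \<open>u\<close> are new; without one the left-hand side is \<open>0\<close>.\<close>
    then obtain p where "p \<in> agree U (insert x e)" by blast
    then have p: "p permutes U" "p a = u" "\<And>b v. (b, v) \<in> e \<Longrightarrow> p b = v"
      by (auto simp: x dest: agreeD agree_permutes)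
    have "a \<notin> fst ` e" "u \<notin> snd ` e"
      using p insert.hyps(2) permutes_inj[OF p(1)] by (auto simp: x inj_eq) (metis inj_eq)
    moreover have "\<not> conflict {(a, u)} b" if "b \<in> J" for b
      using insert.prems(2)[OF that] conflict_mono[of "{(a, u)}" b "insert x e"] by (auto simp: x)
    ultimately have *: "(card U - card e) * card (agree U (insert x e) \<inter> avoid U J)
        \<le> card (agree U e \<inter> avoid U J)"
      unfolding x using insert by (intro card_agree_insert_avoid_le U) (auto simp: x)
    have IH: "(\<Prod>i<card e. card U - i) * card (agree U e \<inter> avoid U J) \<le> card (avoid U J)"
    proof (rule insert.IH)
      show "e \<subseteq> U \<times> U" using insert.prems(1) by blast
      show "\<not> conflict e b" if "b \<in> J" for b
        using insert.prems(2)[OF that] conflict_mono[of e b "insert x e"] by blast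
    qed
    have "(\<Prod>i<card (insert x e). card U - i) * card (agree U (insert x e) \<inter> avoid U J)
      = (\<Prod>i<card e. card U - i) * ((card U - card e) * card (agree U (insert x e) \<inter> avoid U J))"
      using insert.hyps by simp
    also have "\<dots> \<le> (\<Prod>i<card e. card U - i) * card (agree U e \<inter> avoid U J)"
      by (intro mult_left_mono *) auto
    finally show ?thesis using IH by linarith
  qed auto
qed

lemma card_avoid_insert:
  assumes "finite U"
  shows "real (card (avoid U (insert b J))) = real (card (avoid U J)) - real (card (agree U b \<inter> avoid U J))"
proof -
  have "avoid U (insert b J) = avoid U J - agree U b \<inter> avoid U J"
    by (auto simp: avoid_def)
  then have "card (avoid U (insert b J)) = card (avoid U J) - card (agree U b \<inter> avoid U J)"
    using assms by (simp add: card_Diff_subset)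
  then show ?thesis using assms card_mono[of "avoid U J" "agree U b \<inter> avoid U J"]
    by (simp add: of_nat_diff)
qed

text \<open>The chain rule: the events of \<open>J - J'\<close> are excluded one after the other,
  each exclusion keeping at least the fraction \<open>1 - x\<close>.\<close>

lemma card_avoid_ge_power:
  fixes x :: real
  assumes "finite U" "finite J" "J' \<subseteq> J" "x \<le> 1"
    and le: "\<And>b I. b \<in> J \<Longrightarrow> I \<subseteq> J - {b} \<Longrightarrow>
               real (card (agree U b \<inter> avoid U I)) \<le> x * card (avoid U I)"
  shows "(1 - x) ^ card (J - J') * card (avoid U J') \<le> card (avoid U J)"
proof -
  have "(1 - x) ^ card I * card (avoid U J') \<le> card (avoid U (J' \<union> I))"
    if "finite I" "I \<subseteq> J - J'" for I
    using that
  proof (induction I)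
    case (insert b I)
    have "(1 - x) ^ card (insert b I) * card (avoid U J')
        = (1 - x) * ((1 - x) ^ card I * card (avoid U J'))" using insert by simp
    also have "\<dots> \<le> (1 - x) * card (avoid U (J' \<union> I))"
      using insert assms by (intro mult_left_mono) auto
    also have "\<dots> = card (avoid U (J' \<union> I)) - x * card (avoid U (J' \<union> I))"
      by (simp add: algebra_simps)
    also have "\<dots> \<le> card (avoid U (J' \<union> I)) - real (card (agree U b \<inter> avoid U (J' \<union> I)))"
      using le[of b "J' \<union> I"] insert.hyps insert.prems assms(3)
      by (simp add: subset_iff) (metis Diff_iff)
    also have "\<dots> = card (avoid U (J' \<union> insert b I))"
      using card_avoid_insert[OF assms(1), of b "J' \<union> I"] by simp
    finally show ?case .
  qed auto
  from this[of "J - J'"] show ?thesis using assms by (auto simp: Un_absorb1)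
qed

text \<open>The usual proof, by induction on \<open>card J\<close>. Let \<open>J'\<close> be the
  part of \<open>J\<close> without conflicts with \<open>e\<close>. Negative correlation bounds the
  event given \<open>avoid U J'\<close>, and by the induction hypothesis the remaining events, at
  most \<open>N\<close> of them, shrink the condition by no more than \<open>(1 - x) ^ N\<close>.
  The hypothesis \<open>p\<close> is the symmetric condition for events of probability
  \<open>1 / (\<Prod>i<r. card U - i)\<close>.\<close>

lemma lopsided_local_lemma:
  fixes x :: real
  assumes U: "finite U" and F: "finite F" and x: "0 \<le> x" "x < 1"
    and F2: "\<And>e. e \<in> F \<Longrightarrow> finite e \<and> e \<subseteq> U \<times> U \<and> card e = r"
    and deg: "\<And>e. e \<in> F \<Longrightarrow> card {b \<in> F. conflict e b} \<le> N"
    and p: "1 \<le> real (\<Prod>i<r. card U - i) * (x * (1 - x) ^ N)"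
    and "J \<subseteq> F" "e \<in> F"
  shows "card (agree U e \<inter> avoid U J) \<le> x * card (avoid U J)"
  using assms(8,9)
proof (induction "card J" arbitrary: J e rule: less_induct)
  case less
  have fJ: "finite J" using less.prems F finite_subset by blast
  define J' where "J' = {b \<in> J. \<not> conflict e b}"
  let ?P = "real (\<Prod>i<r. card U - i)"
  have "(1 - x) ^ N * card (avoid U J') \<le> (1 - x) ^ card (J - J') * card (avoid U J')"
  proof (intro mult_right_mono power_decreasing)
    have "card (J - J') \<le> card {b \<in> F. conflict e b}"
      using F less.prems by (intro card_mono) (auto simp: J'_def)
    then show "card (J - J') \<le> N" using deg[OF less.prems(2)] by simp
  qed (use x in auto)
  also have "\<dots> \<le> card (avoid U J)"
  proof (rule card_avoid_ge_power[OF U fJ])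
    fix b I assume bI: "b \<in> J" "I \<subseteq> J - {b}"
    then have "card I < card J" using fJ by (intro psubset_card_mono) auto
    then show "real (card (agree U b \<inter> avoid U I)) \<le> x * card (avoid U I)"
      using bI less.prems by (intro less.hyps) auto
  qed (use x in \<open>auto simp: J'_def\<close>)
  finally have 1: "(1 - x) ^ N * card (avoid U J') \<le> card (avoid U J)" .
  have "card (agree U e \<inter> avoid U J) \<le> card (agree U e \<inter> avoid U J')"
    using U avoid_antimono[of J' J U] by (intro card_mono) (auto simp: J'_def)
  then have "?P * card (agree U e \<inter> avoid U J) \<le> ?P * card (agree U e \<inter> avoid U J')"
    by (intro mult_left_mono) (auto intro: prod_nonneg)
  also have "\<dots> \<le> card (avoid U J')"
    using card_agree_avoid_le[OF U, of e J'] F2[OF less.prems(2)]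
    by (simp only: J'_def of_nat_mult[symmetric] of_nat_le_iff) auto
  finally have 2: "?P * card (agree U e \<inter> avoid U J) \<le> card (avoid U J')" .
  have "card (agree U e \<inter> avoid U J) \<le> ?P * (x * (1 - x) ^ N) * card (agree U e \<inter> avoid U J)"
    using mult_right_mono[OF p, of "real (card (agree U e \<inter> avoid U J))"] by simp
  also have "\<dots> = x * (1 - x) ^ N * (?P * card (agree U e \<inter> avoid U J))" by (simp only: mult_ac)
  also have "\<dots> \<le> x * (1 - x) ^ N * card (avoid U J')"
    by (rule mult_left_mono[OF 2]) (use x in auto)
  also have "\<dots> \<le> x * card (avoid U J)"
    using mult_left_mono[OF 1, of x] x by (simp add: mult_ac)
  finally show ?case .
qed

section \<open>The probability of avoiding all loops\<close>

text \<open>Slots and points share the ground set \<open>U\<close>, so that a configuration is a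
  permutation of it: \<open>c\<close> sends a slot to its edge and \<open>g\<close> a point to its
  vertex. Edges have at most \<open>k\<close> slots, vertices at most \<open>D\<close>
  points.\<close>

locale labelled_set =
  fixes U :: "'a set" and c :: "'a \<Rightarrow> 'b" and g :: "'a \<Rightarrow> 'c" and k D :: nat
  assumes fin: "finite U" and ne: "U \<noteq> {}"
    and card_c: "\<And>a. a \<in> U \<Longrightarrow> card {b \<in> U. c b = c a} \<le> k"
    and card_g: "\<And>a. a \<in> U \<Longrightarrow> card {b \<in> U. g b = g a} \<le> D"
    and small: "1000 * (k * D) \<le> card U"
begin

definition loops :: "('a \<times> 'a) set set" where
  "loops = {{(a, u), (b, v)} |a b u v. {a, b, u, v} \<subseteq> U \<and> a \<noteq> b \<and> u \<noteq> v \<and> c a = c b \<and> g u = g v}"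

text \<open>The scale of the relative errors when the conditional probability of a loop is compared
  with \<open>1 / card U ^ 2\<close>.\<close>

definition \<tau> :: real where "\<tau> = real (k * D) / card U"

text \<open>The weight in the local lemma: a loop has probability \<open>1 / (M (M - 1))\<close> and at most \<open>4 \<tau> M\<^sup>2\<close>
  conflicts, where \<open>M = card U\<close>, and \<open>\<xi>\<close> satisfies \<open>1 / (M (M - 1)) \<le> \<xi> (1 - \<xi>) ^ (4 \<tau> M\<^sup>2)\<close>.\<close>

definition \<xi> :: real where "\<xi> = (1 + 16 * \<tau>) / real (card U) ^ 2"

section \<open>Numerical bounds for the parameters\<close>

lemma kD_pos: "1 \<le> k * D"
proof -
  obtain a where a: "a \<in> U" using ne by blast
  have "card {b \<in> U. c b = c a} > 0" "card {b \<in> U. g b = g a} > 0"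
    using a fin by (auto simp: card_gt_0_iff)
  then show ?thesis using card_c[OF a] card_g[OF a] by (simp add: Suc_le_eq)
qed

lemma card_U_ge: "1000 \<le> card U"
  using kD_pos small by linarith

lemma \<tau>_bounds: "0 < \<tau>" "\<tau> \<le> 1 / 1000" "1 / card U \<le> \<tau>"
  using kD_pos small card_U_ge by (auto simp: \<tau>_def divide_simps simp flip: of_nat_mult)

lemma \<tau>_times: "real (k * D) = \<tau> * card U"
  using card_U_ge by (simp add: \<tau>_def)

lemma \<xi>_times: "real (card U) ^ 2 * \<xi> = 1 + 16 * \<tau>"
  using card_U_ge by (simp add: \<xi>_def)

lemma \<xi>_bounds: "0 < \<xi>" "\<xi> \<le> 2 / real (card U) ^ 2" "\<xi> \<le> 1 / 1000"
proof -
  show "0 < \<xi>" "\<xi> \<le> 2 / real (card U) ^ 2" 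
    using \<tau>_bounds card_U_ge by (auto simp: \<xi>_def intro!: divide_pos_pos divide_right_mono)
  moreover have "real (card U) ^ 2 \<ge> 1000 ^ 2" using card_U_ge by (intro power_mono) auto
  then have "2 / real (card U) ^ 2 \<le> 2 / 1000 ^ 2"
    using card_U_ge by (intro divide_left_mono) auto
  ultimately show "\<xi> \<le> 1 / 1000" by simp
qed

section \<open>Loops and their conflicts\<close>

lemma loopsD:
  assumes "e \<in> loops"
  shows "finite e \<and> e \<subseteq> U \<times> U \<and> card e = 2"
  using assms by (auto simp: loops_def)

lemma finite_loops: "finite loops"
  by (rule finite_subset[of _ "Pow (U \<times> U)"]) (use fin loopsD in auto)

text \<open>Either pair of a loop may serve as the first one.\<close>

lemma loops_other:
  assumes "b \<in> loops" "(a, u) \<in> b"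
  obtains a' u' where "b = {(a, u), (a', u')}" "a' \<in> {a' \<in> U. c a' = c a}" "u' \<in> {u' \<in> U. g u' = g u}"
    "a' \<noteq> a" "u' \<noteq> u" "a \<in> U" "u \<in> U"
proof -
  obtain a1 u1 a2 u2 where *: "b = {(a1, u1), (a2, u2)}" "{a1, a2, u1, u2} \<subseteq> U" "a1 \<noteq> a2" "u1 \<noteq> u2"
    "c a1 = c a2" "g u1 = g u2" using assms(1) by (auto simp: loops_def)
  have "a = a1 \<and> u = u1 \<or> a = a2 \<and> u = u2" using assms(2) * by auto
  then show ?thesis
  proof
    assume "a = a1 \<and> u = u1"
    then show ?thesis using * by (intro that[of a2 u2]) auto
  next
    assume "a = a2 \<and> u = u2"
    then show ?thesis using * by (intro that[of a1 u1]) auto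
  qed
qed

text \<open>A conflicting loop has a pair that shares exactly one coordinate with some
  \<open>(a, u)\<close> in \<open>e\<close>. The other coordinate of this pair has at most
  \<open>card U\<close> choices, and the second pair of the loop then at most \<open>k * D\<close>;
  the factor \<open>2\<close> is the choice of the shared coordinate.\<close>

lemma card_conflict_le:
  assumes "finite e" "e \<subseteq> U \<times> U"
  shows "card {b \<in> loops. conflict e b} \<le> card e * (2 * (k * D * card U))"
proof -
  define C where "C a = {b \<in> U. c b = c a}" for a
  define G where "G a = {b \<in> U. g b = g a}" for a
  have fC: "finite (C a)" "finite (G a)" for a using fin by (auto simp: C_def G_def)
  \<comment> \<open>\<open>P\<close> covers the loops that use the slot \<open>a\<close>,
    \<open>Q\<close> those that use the value \<open>u\<close>; supersets suffice.\<close>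
  define P where "P = (\<lambda>(a :: 'a, u :: 'a). (\<lambda>(u', b, v). {(a, u'), (b, v)}) ` (SIGMA u':U. C a \<times> G u'))"
  define Q where "Q = (\<lambda>(a :: 'a, u :: 'a). (\<lambda>(a', b, v). {(a', u), (b, v)}) ` (SIGMA a':U. C a' \<times> G u))"
  have sub: "{b \<in> loops. conflict e b} \<subseteq> (\<Union>z\<in>e. P z \<union> Q z)"
  proof
    fix b assume "b \<in> {b \<in> loops. conflict e b}"
    then obtain a u a' u' where b: "b \<in> loops" "(a, u) \<in> e" "(a', u') \<in> b" "(a = a') \<noteq> (u = u')"
      by (auto simp: conflict_def)
    obtain a2 u2 where *: "b = {(a', u'), (a2, u2)}" "a2 \<in> C a'" "u2 \<in> G u'"
        "a2 \<noteq> a'" "u2 \<noteq> u'" "a' \<in> U" "u' \<in> U"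
      by (rule loops_other[OF b(1,3), folded C_def G_def])
    have "b \<in> P (a, u) \<union> Q (a, u)"
    proof (cases "a = a'")
      case True
      have "b \<in> P (a, u)" unfolding P_def prod.case
        using * True by (intro image_eqI[of _ _ "(u', a2, u2)"]) auto
      then show ?thesis by blast
    next
      case False
      then have "u = u'" using b by auto
      then have "b \<in> Q (a, u)" unfolding Q_def prod.case
        using * by (intro image_eqI[of _ _ "(a', a2, u2)"]) auto
      then show ?thesis by blast
    qed
    then show "b \<in> (\<Union>z\<in>e. P z \<union> Q z)" using b by blast
  qed
  have le: "card (P z \<union> Q z) \<le> 2 * (k * D * card U) \<and> finite (P z \<union> Q z)" if z: "z \<in> e" for z
  proof -
    obtain a u where au: "z = (a, u)" "a \<in> U" "u \<in> U" using z assms by auto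
    have 1: "finite (SIGMA u':U. C a \<times> G u')" "finite (SIGMA a':U. C a' \<times> G u)"
      using fin fC by auto
    have prod_le: "card (C b) * card (G v) \<le> k * D" if "b \<in> U" "v \<in> U" for b v
      using card_c[of b] card_g[of v] that by (intro mult_mono) (auto simp: C_def G_def)
    have "card (P z) \<le> (\<Sum>u'\<in>U. card (C a) * card (G u'))"
      using card_image_le[OF 1(1)] fC fin by (auto simp: P_def au card_SigmaI card_cartesian_product)
    also have "\<dots> \<le> card U * (k * D)"
      using prod_le au by (intro sum_bounded_above[where K = "k * D", simplified]) auto
    finally have P: "card (P z) \<le> card U * (k * D)" .
    have "card (Q z) \<le> (\<Sum>a'\<in>U. card (C a') * card (G u))"
      using card_image_le[OF 1(2)] fC fin by (auto simp: Q_def au card_SigmaI card_cartesian_product)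
    also have "\<dots> \<le> card U * (k * D)"
      using prod_le au by (intro sum_bounded_above[where K = "k * D", simplified]) auto
    finally have Q: "card (Q z) \<le> card U * (k * D)" .
    have "finite (P z)" "finite (Q z)" using 1 by (auto simp: P_def Q_def au)
    then show ?thesis using P Q card_Un_le[of "P z" "Q z"] by (auto simp: algebra_simps)
  qed
  have "card {b \<in> loops. conflict e b} \<le> card (\<Union>z\<in>e. P z \<union> Q z)"
    using sub le assms(1) by (intro card_mono) blast+
  also have "\<dots> \<le> (\<Sum>z\<in>e. card (P z \<union> Q z))" by (rule card_UN_le[OF assms(1)])
  also have "\<dots> \<le> card e * (2 * (k * D * card U))"
    using le by (intro sum_bounded_above[where K = "2 * (k * D * card U)", simplified]) auto
  finally show ?thesis .
qed

text \<open>The local lemma applies with two pairs per event and the conflict count of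
  \<open>card_conflict_le\<close>; what remains is its numerical condition for
  \<open>\<xi>\<close>.\<close>

lemma card_agree_loop_le:
  assumes "J \<subseteq> loops" "e \<in> loops"
  shows "card (agree U e \<inter> avoid U J) \<le> \<xi> * card (avoid U J)"
proof (rule lopsided_local_lemma[OF fin finite_loops, where r = 2 and N = "4 * (k * D * card U)"])
  show "card {b \<in> loops. conflict e b} \<le> 4 * (k * D * card U)" if "e \<in> loops" for e
    using card_conflict_le[of e] loopsD[OF that] by auto
  let ?M = "real (card U)"
  have M: "?M \<ge> 1000" using card_U_ge by simp
  \<comment> \<open>The condition rewritten with \<open>\<xi>_times\<close>:
    \<open>1 - \<tau>\<close> stands for \<open>1 - 1 / ?M\<close>, and the last factor is
    Bernoulli's bound for the power. Together they lose at most \<open>9 * \<tau>\<close>, which the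
    surplus \<open>16 * \<tau>\<close> covers.\<close>
  have "1 \<le> (1 + 16 * \<tau>) * ((1 - \<tau>) * (1 - 4 * \<tau> * (1 + 16 * \<tau>)))"
  proof -
    have "4 * \<tau> * (1 + 16 * \<tau>) \<le> 4 * \<tau> * (2::real)"
      using \<tau>_bounds by (intro mult_left_mono) auto
    then have "1 - 4 * \<tau> * (1 + 16 * \<tau>) \<ge> 1 - 8 * \<tau>" by simp
    then have "(1 - \<tau>) * (1 - 4 * \<tau> * (1 + 16 * \<tau>)) \<ge> (1 - \<tau>) * (1 - 8 * \<tau>)"
      using \<tau>_bounds by (intro mult_left_mono) auto
    moreover have "(1 - \<tau>) * (1 - 8 * \<tau>) \<ge> 1 - 9 * \<tau>" using \<tau>_bounds by (simp add: algebra_simps)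
    ultimately have "(1 - \<tau>) * (1 - 4 * \<tau> * (1 + 16 * \<tau>)) \<ge> 1 - 9 * \<tau>" by linarith
    then have "(1 + 16 * \<tau>) * ((1 - \<tau>) * (1 - 4 * \<tau> * (1 + 16 * \<tau>))) \<ge> (1 + 16 * \<tau>) * (1 - 9 * \<tau>)"
      using \<tau>_bounds by (intro mult_left_mono) auto
    moreover have "\<tau> * \<tau> \<le> \<tau> * (1/1000)" using \<tau>_bounds by (intro mult_left_mono) auto
    then have "(1 + 16 * \<tau>) * (1 - 9 * \<tau>) \<ge> 1" using \<tau>_bounds by (simp add: algebra_simps)
    ultimately show ?thesis by linarith
  qed
  also have "\<dots> \<le> (1 + 16 * \<tau>) * ((1 - 1 / ?M) * (1 - \<xi>) ^ (4 * (k * D * card U)))"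
  proof (intro mult_left_mono mult_mono)
    have "1 - real (4 * (k * D * card U)) * \<xi> \<le> (1 - \<xi>) ^ (4 * (k * D * card U))"
      using Bernoulli_inequality[of "- \<xi>" "4 * (k * D * card U)"] \<xi>_bounds by simp
    moreover have "real (4 * (k * D * card U)) * \<xi> = 4 * \<tau> * (?M ^ 2 * \<xi>)"
      using \<tau>_times by (simp add: power2_eq_square)
    ultimately show "1 - 4 * \<tau> * (1 + 16 * \<tau>) \<le> (1 - \<xi>) ^ (4 * (k * D * card U))"
      using \<xi>_times by simp
    have "4 * \<tau> * (1 + 16 * \<tau>) \<le> 4 * \<tau> * (2::real)"
      using \<tau>_bounds by (intro mult_left_mono) auto
    then show "0 \<le> 1 - 4 * \<tau> * (1 + 16 * \<tau>)" using \<tau>_bounds by linarith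
  qed (use \<tau>_bounds M in auto)
  also have "\<dots> = ?M ^ 2 * (1 - 1 / ?M) * (\<xi> * (1 - \<xi>) ^ (4 * (k * D * card U)))"
    by (simp add: \<xi>_times[symmetric])
  also have "?M ^ 2 * (1 - 1 / ?M) = ?M * (?M - 1)"
    using M by (simp add: field_simps power2_eq_square)
  also have "\<dots> = real (\<Prod>i<2. card U - i)" using M by (simp add: numeral_2_eq_2 of_nat_diff)
  finally show "1 \<le> real (\<Prod>i<2. card U - i) * (\<xi> * (1 - \<xi>) ^ (4 * (k * D * card U)))" .
qed (use assms loopsD \<xi>_bounds in auto)

text \<open>The quotient argument of the local lemma, for a prescription \<open>e\<close> that need
  not be a loop: even given that loops are avoided, its probability is at most twice that of
  independent uniform values. Eight pairs are what four common vertices of two edges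
  require.\<close>

lemma card_agree_avoid_loops_le:
  assumes e: "finite e" "e \<subseteq> U \<times> U" "card e \<le> 8" and J: "J \<subseteq> loops"
  shows "card (agree U e \<inter> avoid U J) \<le> 2 / real (card U) ^ card e * card (avoid U J)"
proof -
  let ?M = "real (card U)" and ?r = "card e" and ?A = "real (card (agree U e \<inter> avoid U J))"
  have M: "?M \<ge> 1000" using card_U_ge by simp
  define N where "N = card e * (2 * (k * D * card U))"
  define J' where "J' = {b \<in> J. \<not> conflict e b}"
  have fJ: "finite J" using J finite_loops finite_subset by blast
  have "(1 - \<xi>) ^ N * card (avoid U J') \<le> (1 - \<xi>) ^ card (J - J') * card (avoid U J')"
  proof (intro mult_right_mono power_decreasing)
    have "card (J - J') \<le> card {b \<in> loops. conflict e b}"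
      using J finite_loops by (intro card_mono) (auto simp: J'_def)
    then show "card (J - J') \<le> N" using card_conflict_le[OF e(1,2)] by (simp add: N_def)
  qed (use \<xi>_bounds in auto)
  also have "\<dots> \<le> card (avoid U J)"
    using J \<xi>_bounds by (intro card_avoid_ge_power[OF fin fJ] card_agree_loop_le) (auto simp: J'_def)
  finally have 1: "(1 - \<xi>) ^ N * card (avoid U J') \<le> card (avoid U J)" .
  have "card (agree U e \<inter> avoid U J) \<le> card (agree U e \<inter> avoid U J')"
    using fin avoid_antimono[of J' J U] by (intro card_mono) (auto simp: J'_def)
  then have "real (\<Prod>i<?r. card U - i) * ?A \<le> real (\<Prod>i<?r. card U - i) * card (agree U e \<inter> avoid U J')"
    by (intro mult_left_mono) (auto intro: prod_nonneg)
  also have "\<dots> \<le> card (avoid U J')"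
    using card_agree_avoid_le[OF fin e(1,2), of J']
    by (simp only: J'_def of_nat_mult[symmetric] of_nat_le_iff) auto
  finally have 2: "real (\<Prod>i<?r. card U - i) * ?A \<le> card (avoid U J')" .
  \<comment> \<open>Each of the at most eight factors is at least \<open>?M - 8\<close>, so that
    Bernoulli's inequality applies.\<close>
  have 3: "?M ^ ?r * (9 / 10) \<le> real (\<Prod>i<?r. card U - i)"
  proof -
    have M8: "- 1 \<le> - 8 / ?M" "- 8 / ?M \<le> 0" using M by (auto simp: field_simps)
    have "9 / 10 \<le> 1 + 8 * (- 8 / ?M)" using M by (simp add: field_simps)
    also have "\<dots> \<le> (1 + (- 8 / ?M)) ^ 8"
      using Bernoulli_inequality[of "- 8 / ?M" 8] M8 by simp
    also have "\<dots> \<le> (1 + (- 8 / ?M)) ^ ?r"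
      using M8 e by (intro power_decreasing) auto
    finally have "?M ^ ?r * (9 / 10) \<le> ?M ^ ?r * (1 + (- 8 / ?M)) ^ ?r"
      by (intro mult_left_mono) auto
    also have "\<dots> = (?M * (1 + (- 8 / ?M))) ^ ?r" by (simp only: power_mult_distrib)
    also have "?M * (1 + (- 8 / ?M)) = ?M - 8" using M by (simp add: field_simps)
    also have "(?M - 8) ^ ?r = (\<Prod>i<?r. ?M - 8)" by simp
    also have "\<dots> \<le> (\<Prod>i<?r. real (card U - i))"
      using M e by (intro prod_mono) auto
    finally show ?thesis by simp
  qed
  have 4: "9 / 10 \<le> (1 - \<xi>) ^ N"
  proof -
    have "1 - real N * \<xi> \<le> (1 - \<xi>) ^ N"
      using Bernoulli_inequality[of "- \<xi>" N] \<xi>_bounds by simp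
    moreover have "real N * \<xi> = real ?r * 2 * (\<tau> * (?M ^ 2 * \<xi>))"
      using \<tau>_times by (simp add: N_def power2_eq_square)
    moreover have "real ?r * 2 * (\<tau> * (1 + 16 * \<tau>)) \<le> 8 * 2 * (1 / 1000 * 2)"
      using \<tau>_bounds e by (intro mult_mono) auto
    ultimately show ?thesis using \<xi>_times by simp
  qed
  have "?M ^ ?r * (9 / 10) * ?A \<le> card (avoid U J')"
    using mult_right_mono[OF 3, of ?A] 2 by simp
  then have "(9 / 10) * (?M ^ ?r * (9 / 10) * ?A) \<le> (1 - \<xi>) ^ N * card (avoid U J')"
    using 4 by (intro mult_mono) auto
  \<comment> \<open>The two losses of \<open>9 / 10\<close> leave \<open>81 / 100\<close>, more than
    the \<open>1 / 2\<close> that is needed.\<close>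
  then have 5: "81 / 100 * (?M ^ ?r * ?A) \<le> card (avoid U J)" using 1 by simp
  have "?M ^ ?r * ?A \<le> 2 * card (avoid U J)" using 5 by simp
  then show ?thesis using M by (simp add: field_simps)
qed

text \<open>The union bound used for every exceptional set below.\<close>

lemma card_UN_agree_avoid_le:
  assumes "finite I" "\<And>i. i \<in> I \<Longrightarrow> finite (E i) \<and> E i \<subseteq> U \<times> U \<and> card (E i) = r" "r \<le> 8"
    and J: "J \<subseteq> loops" and S: "S \<subseteq> (\<Union>i\<in>I. agree U (E i) \<inter> avoid U J)"
  shows "card S \<le> real (card I) * (2 / real (card U) ^ r * card (avoid U J))"
proof -
  have "card S \<le> card (\<Union>i\<in>I. agree U (E i) \<inter> avoid U J)"
    using assms fin by (intro card_mono) auto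
  also have "\<dots> \<le> (\<Sum>i\<in>I. card (agree U (E i) \<inter> avoid U J))" by (rule card_UN_le[OF assms(1)])
  finally have "real (card S) \<le> (\<Sum>i\<in>I. real (card (agree U (E i) \<inter> avoid U J)))"
    by (simp flip: of_nat_sum)
  also have "\<dots> \<le> (\<Sum>i\<in>I. 2 / real (card U) ^ r * card (avoid U J))"
    using card_agree_avoid_loops_le[OF _ _ _ J] assms by (intro sum_mono) metis
  finally show ?thesis by simp
qed

text \<open>Switching: composing a permutation with a transposition of values forces \<open>a \<mapsto> u\<close>,
  and by the union bound this rarely creates a loop.\<close>

lemma card_agree_insert_avoid_ge:
  assumes e: "finite e" "e \<subseteq> U \<times> U" "card e \<le> 5"
    and au: "a \<in> U" "u \<in> U" "a \<notin> fst ` e" "u \<notin> snd ` e" and J: "J \<subseteq> loops"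
    and disj: "\<And>b z v. b \<in> J \<Longrightarrow> (z, v) \<in> b \<Longrightarrow> z \<notin> insert a (fst ` e) \<and> v \<notin> insert u (snd ` e)"
  shows "card (agree U e \<inter> avoid U J) - 2 * \<tau> / real (card U) ^ card e * card (avoid U J)
           \<le> card U * real (card (agree U (insert (a, u) e) \<inter> avoid U J))"
proof -
  let ?M = "real (card U)"
  \<comment> \<open>After \<open>\<phi>\<close> the slot \<open>a\<close> has value
    \<open>u\<close>, and the slot that had value \<open>u\<close> receives the former value of
    \<open>a\<close>; no other slot changes.\<close>
  define \<phi> where "\<phi> p = transpose (p a) u \<circ> p" for p
  define Good where "Good = {p \<in> agree U e \<inter> avoid U J. \<phi> p \<in> avoid U J}"
  define Bad where "Bad = {p \<in> agree U e \<inter> avoid U J. \<phi> p \<notin> avoid U J}"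
  have \<phi>_perm: "\<phi> p permutes U" if "p permutes U" for p
    using that au permutes_in_image[OF that]
    unfolding \<phi>_def by (intro permutes_compose permutes_swap_id) auto
  have \<phi>_a: "\<phi> p a = u" for p by (simp add: \<phi>_def)
  have \<phi>_other: "\<phi> p b = (if p b = u then p a else p b)" if "p permutes U" "b \<noteq> a" for p b
    using that permutes_inj[OF that(1)] by (auto simp: \<phi>_def transpose_def inj_eq)
  \<comment> \<open>A permutation \<open>p\<close> is recovered from \<open>\<phi> p\<close> and the
    overwritten value \<open>p a\<close>, whence the factor \<open>card U\<close>.\<close>
  have good: "card Good \<le> card U * card (agree U (insert (a, u) e) \<inter> avoid U J)"
  proof -
    have "\<phi> p \<in> agree U (insert (a, u) e)" if p: "p \<in> agree U e" for p
    proof -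
      have "\<phi> p b = v" if "(b, v) \<in> e" for b v
        using \<phi>_other[OF agree_permutes[OF p], of b] agreeD[OF p that] that au by force
      then show ?thesis using \<phi>_perm[OF agree_permutes[OF p]] \<phi>_a by (auto simp: agree_def)
    qed
    moreover have "p a \<in> U" if "p \<in> agree U e" for p
      using au permutes_in_image[OF agree_permutes[OF that]] by auto
    ultimately have "(\<lambda>p. (p a, \<phi> p)) ` Good \<subseteq> U \<times> (agree U (insert (a, u) e) \<inter> avoid U J)"
      by (auto simp: Good_def)
    moreover have "inj_on (\<lambda>p. (p a, \<phi> p)) Good"
      unfolding \<phi>_def
      by (rule inj_onI) (metis (no_types, opaque_lifting) comp_assoc id_comp prod.inject transpose_comp_involutory)
    ultimately have "card Good \<le> card (U \<times> (agree U (insert (a, u) e) \<inter> avoid U J))"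
      using fin by (intro card_inj_on_le) auto
    then show ?thesis by (simp add: card_cartesian_product)
  qed
  \<comment> \<open>If \<open>\<phi> p\<close> creates the loop \<open>{(z, w), (b, v)}\<close>,
    then \<open>z\<close> is the slot with \<open>p z = u\<close> and \<open>w = p a\<close>, while
    \<open>p b = v\<close> already. So \<open>p\<close> itself meets three prescriptions beyond
    \<open>e\<close>; there are at most \<open>card U ^ 2\<close> choices of \<open>z\<close> and
    \<open>w\<close> and then \<open>k * D\<close> of \<open>b\<close> and \<open>v\<close>.\<close>
  define E where "E = (\<lambda>(z, w, b, v). e \<union> {(z, u), (a, w), (b, v)})"
  define I0 where "I0 = (SIGMA z:U. SIGMA w:U. {b \<in> U. c b = c z} \<times> {v \<in> U. g v = g w})"
  define I where "I = {i \<in> I0. E i \<subseteq> U \<times> U \<and> card (E i) = card e + 3}"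
  have I0: "finite I0" using fin by (auto simp: I0_def)
  have "Bad \<subseteq> (\<Union>i\<in>I. agree U (E i) \<inter> avoid U J)"
  proof
    fix p assume p: "p \<in> Bad"
    then have pU: "p permutes U" and pe: "p \<in> agree U e" and pJ: "p \<in> avoid U J"
      and p\<phi>: "\<phi> p \<notin> avoid U J"
      by (auto simp: Bad_def dest: avoid_permutes)
    have inj: "p y = p y' \<longleftrightarrow> y = y'" for y y' using permutes_inj[OF pU] by (simp add: inj_eq)
    from p\<phi> \<phi>_perm[OF pU] obtain B where B: "B \<in> J" "\<phi> p \<in> agree U B" by (auto simp: avoid_def)
    with pJ pU have "p \<notin> agree U B" by (auto simp: avoid_def)
    with pU obtain z w where zw: "(z, w) \<in> B" "p z \<noteq> w" by (auto simp: agree_def)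
    obtain b v where bv: "B = {(z, w), (b, v)}" "b \<in> {b \<in> U. c b = c z}" "v \<in> {v \<in> U. g v = g w}"
        "b \<noteq> z" "v \<noteq> w" "z \<in> U" "w \<in> U"
      by (rule loops_other[OF _ zw(1)]) (use J B(1) in blast)
    have da: "z \<notin> insert a (fst ` e)" "b \<notin> insert a (fst ` e)"
      using disj[OF B(1), of z w] disj[OF B(1), of b v] bv(1) by auto
    have z: "p z = u" "p a = w"
      using agreeD[OF B(2) zw(1)] \<phi>_other[OF pU, of z] zw(2) da by (auto split: if_splits)
    have b: "p b = v"
      using agreeD[OF B(2), of b v] \<phi>_other[OF pU, of b] da bv z inj[of b z] by (auto split: if_splits)
    have E: "E (z, w, b, v) = insert (z, u) (insert (a, w) (insert (b, v) e))"
      by (auto simp: E_def)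
    have "(z, u) \<notin> e" "(a, w) \<notin> e" "(b, v) \<notin> e" using da au by force+
    then have "card (E (z, w, b, v)) = card e + 3" unfolding E using da bv e by auto
    then have "(z, w, b, v) \<in> I" using bv e au by (auto simp: I_def I0_def E)
    moreover have "p \<in> agree U (E (z, w, b, v))" using pe z b by (auto simp: agree_def E)
    ultimately show "p \<in> (\<Union>i\<in>I. agree U (E i) \<inter> avoid U J)" using pJ by blast
  qed
  moreover have "finite I" using I0 by (rule finite_subset[rotated]) (auto simp: I_def)
  moreover have "finite (E i) \<and> E i \<subseteq> U \<times> U \<and> card (E i) = card e + 3" if "i \<in> I" for i
    using that finite_subset[of "E i" "U \<times> U"] fin unfolding I_def by blast
  ultimately have "card Bad \<le> real (card I) * (2 / ?M ^ (card e + 3) * card (avoid U J))"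
    using e J by (intro card_UN_agree_avoid_le[where E = E]) auto
  also have "\<dots> \<le> (?M * (?M * (k * D))) * (2 / ?M ^ (card e + 3) * card (avoid U J))"
  proof (intro mult_right_mono)
    have "card I \<le> card I0" using I0 by (intro card_mono) (auto simp: I_def)
    also have "\<dots> = (\<Sum>z\<in>U. \<Sum>w\<in>U. card {b \<in> U. c b = c z} * card {v \<in> U. g v = g w})"
      using fin by (simp add: I0_def card_SigmaI card_cartesian_product)
    also have "\<dots> \<le> (\<Sum>z\<in>U. \<Sum>w\<in>U. k * D)"
      by (intro sum_mono mult_mono card_c card_g) auto
    finally have "card I \<le> card U * (card U * (k * D))" by simp
    then show "real (card I) \<le> ?M * (?M * (k * D))" by (simp only: of_nat_mult[symmetric] of_nat_le_iff)
  qed auto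
  also have "?M * (?M * (k * D)) * (2 / ?M ^ (card e + 3) * card (avoid U J))
      = 2 * \<tau> / ?M ^ card e * card (avoid U J)"
    using card_U_ge by (simp add: \<tau>_def power_add power3_eq_cube mult_ac)
  finally have bad: "card Bad \<le> 2 * \<tau> / ?M ^ card e * card (avoid U J)" .
  have "card (agree U e \<inter> avoid U J) = card (Good \<union> Bad)"
    by (rule arg_cong[where f = card]) (auto simp: Good_def Bad_def)
  also have "\<dots> \<le> card Good + card Bad" by (rule card_Un_le)
  finally have "real (card (agree U e \<inter> avoid U J)) \<le> real (card Good) + card Bad"
    by (simp flip: of_nat_add)
  moreover have "real (card Good) \<le> ?M * real (card (agree U (insert (a, u) e) \<inter> avoid U J))"
    using good by (simp only: of_nat_mult[symmetric] of_nat_le_iff)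
  ultimately show ?thesis using bad by linarith
qed

text \<open>Two switchings prescribe the pairs of \<open>e0\<close> while avoiding the loops of
  \<open>J\<close> that are disjoint from \<open>e0\<close>; each loses \<open>2 * \<tau>\<close>.
  The other loops of \<open>J\<close> share one pair with \<open>e0\<close>; one of them holding
  together with \<open>e0\<close> means three prescribed pairs, with at most
  \<open>2 * (k * D)\<close> choices for the third, which loses another
  \<open>4 * \<tau>\<close>.\<close>

lemma card_agree_loop_ge:
  assumes e0: "e0 \<in> loops" "e0 \<notin> J" and J: "J \<subseteq> loops" "\<And>b. b \<in> J \<Longrightarrow> \<not> conflict e0 b"
  shows "(1 - 8 * \<tau>) / real (card U) ^ 2 * card (avoid U J) \<le> card (agree U e0 \<inter> avoid U J)"
proof -
  let ?M = "real (card U)"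
  have M: "?M \<ge> 1000" using card_U_ge by simp
  obtain i u j v where e: "e0 = {(i, u), (j, v)}" "{i, j, u, v} \<subseteq> U" "i \<noteq> j" "u \<noteq> v"
    using e0 by (auto simp: loops_def)
  define J1 where "J1 = {b \<in> J. e0 \<inter> b = {}}"
  have J1: "J1 \<subseteq> loops" "J1 \<subseteq> J" using J by (auto simp: J1_def)
  let ?G = "real (card (avoid U J1))"
  \<comment> \<open>A loop that neither conflicts with \<open>e0\<close> nor shares a pair with it
    shares no slot and no value.\<close>
  have disj: "z \<notin> {i, j} \<and> w \<notin> {u, v}" if "b \<in> J1" "(z, w) \<in> b" for b z w
  proof -
    have "\<not> conflict e0 b" "e0 \<inter> b = {}" using that J by (auto simp: J1_def)
    then show ?thesis using that(2) unfolding conflict_def e by auto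
  qed
  have "?G - 2 * \<tau> / ?M ^ card ({} :: ('a \<times> 'a) set) * ?G
      \<le> ?M * card (agree U {(i, u)} \<inter> avoid U J1)"
    using card_agree_insert_avoid_ge[of "{}" i u J1] e disj J1
    by (auto simp: agree_def avoid_def Int_absorb1)
  then have 1: "(1 - 2 * \<tau>) * ?G \<le> ?M * card (agree U {(i, u)} \<inter> avoid U J1)"
    by (simp add: algebra_simps)
  have "card (agree U {(i, u)} \<inter> avoid U J1) - 2 * \<tau> / ?M ^ card {(i, u)} * ?G
      \<le> ?M * card (agree U (insert (j, v) {(i, u)}) \<inter> avoid U J1)"
    by (rule card_agree_insert_avoid_ge) (use e disj J1 in auto)
  then have "?M * (card (agree U {(i, u)} \<inter> avoid U J1) - 2 * \<tau> / ?M * ?G)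
      \<le> ?M * (?M * card (agree U e0 \<inter> avoid U J1))"
    using e by (intro mult_left_mono) (auto simp: insert_commute)
  then have "?M * card (agree U {(i, u)} \<inter> avoid U J1) - 2 * \<tau> * ?G
      \<le> ?M ^ 2 * card (agree U e0 \<inter> avoid U J1)"
    using M by (simp add: right_diff_distrib power2_eq_square mult.assoc)
  with 1 have 2: "(1 - 4 * \<tau>) * ?G \<le> ?M ^ 2 * card (agree U e0 \<inter> avoid U J1)"
    by (simp add: algebra_simps)
  \<comment> \<open>What is lost by avoiding also the loops of \<open>J\<close> outside
    \<open>J1\<close>; such a loop consists of a pair of \<open>e0\<close> and a new pair from
    \<open>Q\<close>.\<close>
  define S where "S = (agree U e0 \<inter> avoid U J1) - avoid U J"
  define Q where "Q = {q \<in> ({b \<in> U. c b = c i} \<times> {w \<in> U. g w = g u}) \<union>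
                          ({b \<in> U. c b = c j} \<times> {w \<in> U. g w = g v}). q \<notin> e0}"
  have "S \<subseteq> (\<Union>q\<in>Q. agree U (insert q e0) \<inter> avoid U J1)"
  proof
    fix p assume p: "p \<in> S"
    then obtain b where b: "b \<in> J" "p \<in> agree U b"
      by (auto simp: S_def avoid_def)
    then have "b \<notin> J1" using p by (auto simp: S_def avoid_def)
    then have "(i, u) \<in> b \<or> (j, v) \<in> b" using b e by (auto simp: J1_def)
    then obtain q where q: "q \<in> b" "b = {(i, u), q} \<and> q \<in> {b \<in> U. c b = c i} \<times> {w \<in> U. g w = g u}
        \<or> b = {(j, v), q} \<and> q \<in> {b \<in> U. c b = c j} \<times> {w \<in> U. g w = g v}"
    proof
      assume iu: "(i, u) \<in> b"
      have "b \<in> loops" using b J by auto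
      then obtain b' v' where "b = {(i, u), (b', v')}" "b' \<in> {b \<in> U. c b = c i}" "v' \<in> {w \<in> U. g w = g u}"
        "b' \<noteq> i" "v' \<noteq> u" "i \<in> U" "u \<in> U"
        by (rule loops_other[OF _ iu])
      then show ?thesis by (intro that[of "(b', v')"]) auto
    next
      assume jv: "(j, v) \<in> b"
      have "b \<in> loops" using b J by auto
      then obtain b' v' where "b = {(j, v), (b', v')}" "b' \<in> {b \<in> U. c b = c j}" "v' \<in> {w \<in> U. g w = g v}"
        "b' \<noteq> j" "v' \<noteq> v" "j \<in> U" "v \<in> U"
        by (rule loops_other[OF _ jv])
      then show ?thesis by (intro that[of "(b', v')"]) auto
    qed
    have cb: "card b = 2" "card e0 = 2" "finite e0" using b J e0 loopsD by blast+
    have "q \<notin> e0"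
    proof
      assume "q \<in> e0"
      then have "b \<subseteq> e0" using q e by auto
      then have "b = e0" using cb by (intro card_subset_eq) auto
      then show False using b e0 by auto
    qed
    then have "q \<in> Q" using q by (auto simp: Q_def)
    moreover have "p \<in> agree U (insert q e0)"
      using p b q(1) by (auto simp: S_def agree_def)
    ultimately show "p \<in> (\<Union>q\<in>Q. agree U (insert q e0) \<inter> avoid U J1)"
      using p by (auto simp: S_def)
  qed
  moreover have "finite Q" using fin by (auto simp: Q_def)
  moreover have "finite (insert q e0) \<and> insert q e0 \<subseteq> U \<times> U \<and> card (insert q e0) = 3" if "q \<in> Q" for q
    using loopsD[OF e0(1)] that by (auto simp: Q_def)
  ultimately have "card S \<le> real (card Q) * (2 / ?M ^ 3 * ?G)"
    using J1 by (intro card_UN_agree_avoid_le[where E = "\<lambda>q. insert q e0"]) auto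
  also have "\<dots> \<le> (2 * (\<tau> * ?M)) * (2 / ?M ^ 3 * ?G)"
  proof (intro mult_right_mono)
    have "card Q \<le> card (({b \<in> U. c b = c i} \<times> {w \<in> U. g w = g u}) \<union>
                          ({b \<in> U. c b = c j} \<times> {w \<in> U. g w = g v}))"
      using fin by (intro card_mono) (auto simp: Q_def)
    also have "\<dots> \<le> card {b \<in> U. c b = c i} * card {w \<in> U. g w = g u}
                   + card {b \<in> U. c b = c j} * card {w \<in> U. g w = g v}"
      by (rule order_trans[OF card_Un_le]) (simp add: card_cartesian_product)
    also have "\<dots> \<le> k * D + k * D"
      using e by (intro add_mono mult_mono card_c card_g) auto
    finally have "real (card Q) \<le> 2 * real (k * D)" by linarith
    then show "real (card Q) \<le> 2 * (\<tau> * ?M)" by (simp add: \<tau>_times[symmetric])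
  qed auto
  finally have "?M ^ 2 * card S \<le> ?M ^ 2 * (2 * (\<tau> * ?M) * (2 / ?M ^ 3 * ?G))"
    by (intro mult_left_mono) auto
  also have "\<dots> = 4 * \<tau> * ?G" using M by (simp add: field_simps power2_eq_square power3_eq_cube)
  finally have 3: "?M ^ 2 * card S \<le> 4 * \<tau> * ?G" .
  have "agree U e0 \<inter> avoid U J1 = S \<union> (agree U e0 \<inter> avoid U J)"
    using avoid_antimono[OF J1(2), of U] by (auto simp: S_def)
  then have "card (agree U e0 \<inter> avoid U J1) \<le> card S + card (agree U e0 \<inter> avoid U J)"
    using card_Un_le by metis
  then have "real (card (agree U e0 \<inter> avoid U J1)) - card S \<le> card (agree U e0 \<inter> avoid U J)" by linarith
  then have "?M ^ 2 * (real (card (agree U e0 \<inter> avoid U J1)) - card S) \<le> ?M ^ 2 * card (agree U e0 \<inter> avoid U J)"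
    by (intro mult_left_mono) auto
  with 2 3 have "(1 - 8 * \<tau>) * ?G \<le> ?M ^ 2 * card (agree U e0 \<inter> avoid U J)"
    by (simp add: algebra_simps)
  moreover have "(1 - 8 * \<tau>) * card (avoid U J) \<le> (1 - 8 * \<tau>) * ?G"
    using \<tau>_bounds avoid_antimono[OF J1(2), of U] fin by (intro mult_left_mono) (auto intro: card_mono)
  ultimately have "(1 - 8 * \<tau>) * card (avoid U J) \<le> ?M ^ 2 * card (agree U e0 \<inter> avoid U J)" by linarith
  then show ?thesis using M by (simp add: field_simps)
qed

text \<open>The loops are revealed one at a time. Within \<open>agree U e\<close>, the loops that
  conflict with \<open>e\<close> are avoided automatically, so the lower bound for non-conflicting
  loops extends to all of \<open>I\<close>; the comparison is in the right direction since
  \<open>avoid U I\<close> lies in \<open>avoid U I'\<close>.\<close>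

lemma card_avoid_loops_le_power:
  assumes "finite I" "I \<subseteq> loops"
  shows "card (avoid U I) \<le> (1 - (1 - 8 * \<tau>) / real (card U) ^ 2) ^ card I * fact (card U)"
  using assms
proof (induction I)
  case empty
  then show ?case using card_permutations[OF refl fin] by (simp add: avoid_def)
next
  case (insert e I)
  let ?y = "(1 - 8 * \<tau>) / real (card U) ^ 2"
  define I' where "I' = {b \<in> I. \<not> conflict e b}"
  have "?y * card (avoid U I) \<le> ?y * card (avoid U I')"
    using \<tau>_bounds fin avoid_antimono[of I' I U]
    by (intro mult_left_mono) (auto simp: I'_def intro!: card_mono divide_nonneg_nonneg)
  also have "\<dots> \<le> card (agree U e \<inter> avoid U I')"
    using insert by (intro card_agree_loop_ge) (auto simp: I'_def)
  also have "agree U e \<inter> avoid U I' = agree U e \<inter> avoid U I"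
    using agree_conflict[of e _ U] by (auto simp: avoid_def I'_def)
  finally have "card (avoid U (insert e I)) \<le> (1 - ?y) * card (avoid U I)"
    using card_avoid_insert[OF fin, of e I] by (simp add: left_diff_distrib)
  also have "\<dots> \<le> (1 - ?y) * ((1 - ?y) ^ card I * fact (card U))"
  proof (intro mult_left_mono)
    have "?y \<le> 1 / 1" using \<tau>_bounds card_U_ge by (intro frac_le) auto
    then show "0 \<le> 1 - ?y" by simp
  qed (use insert in auto)
  finally show ?case using insert by simp
qed

text \<open>A loop arises from exactly two choices of ordered pairs, \<open>((a, b), (u, v))\<close>
  and the one with both swapped.\<close>

lemma card_loops:
  "2 * card loops = card {(a, b). a \<in> U \<and> b \<in> U \<and> a \<noteq> b \<and> c a = c b}
                     * card {(u, v). u \<in> U \<and> v \<in> U \<and> u \<noteq> v \<and> g u = g v}"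
proof -
  define Pc where "Pc = {(a, b). a \<in> U \<and> b \<in> U \<and> a \<noteq> b \<and> c a = c b}"
  define Pg where "Pg = {(u, v). u \<in> U \<and> v \<in> U \<and> u \<noteq> v \<and> g u = g v}"
  define h where "h = (\<lambda>((a :: 'a, b), (u :: 'a, v)). {(a, u), (b, v)})"
  have f: "finite Pc" "finite Pg"
    by (rule finite_subset[of _ "U \<times> U"]; use fin in \<open>auto simp: Pc_def Pg_def\<close>)+
  have im: "h ` (Pc \<times> Pg) = loops"
  proof
    show "h ` (Pc \<times> Pg) \<subseteq> loops"
      unfolding h_def Pc_def Pg_def loops_def by fast
    show "loops \<subseteq> h ` (Pc \<times> Pg)"
    proof
      fix e assume "e \<in> loops"
      then obtain a u b v where "e = {(a, u), (b, v)}" "{a, b, u, v} \<subseteq> U" "a \<noteq> b" "u \<noteq> v" "c a = c b" "g u = g v"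
        unfolding loops_def by blast
      then show "e \<in> h ` (Pc \<times> Pg)"
        by (intro image_eqI[of _ _ "((a, b), (u, v))"]) (auto simp: h_def Pc_def Pg_def)
    qed
  qed
  have fib: "card {y \<in> Pc \<times> Pg. h y = e} = 2" if "e \<in> loops" for e
  proof -
    obtain a u b v where e: "e = {(a, u), (b, v)}" "{a, b, u, v} \<subseteq> U" "a \<noteq> b" "u \<noteq> v" "c a = c b" "g u = g v"
      using \<open>e \<in> loops\<close> unfolding loops_def by blast
    have "{y \<in> Pc \<times> Pg. h y = e} = {((a, b), (u, v)), ((b, a), (v, u))}"
    proof
      show "{((a, b), (u, v)), ((b, a), (v, u))} \<subseteq> {y \<in> Pc \<times> Pg. h y = e}"
        using e by (auto simp: h_def Pc_def Pg_def)
      show "{y \<in> Pc \<times> Pg. h y = e} \<subseteq> {((a, b), (u, v)), ((b, a), (v, u))}"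
      proof
        fix y assume y: "y \<in> {y \<in> Pc \<times> Pg. h y = e}"
        obtain a' b' u' v' where y': "y = ((a', b'), (u', v'))" by (metis surj_pair)
        have "{(a', u'), (b', v')} = {(a, u), (b, v)}" using y e(1) by (simp add: y' h_def)
        then show "y \<in> {((a, b), (u, v)), ((b, a), (v, u))}" by (auto simp: y' doubleton_eq_iff)
      qed
    qed
    then show ?thesis using e by simp
  qed
  have "card (Pc \<times> Pg) = (\<Sum>y\<in>Pc \<times> Pg. 1)" by simp
  also have "\<dots> = (\<Sum>e\<in>h ` (Pc \<times> Pg). \<Sum>y\<in>{y \<in> Pc \<times> Pg. h y = e}. 1)"
    using f by (intro sum.image_gen) auto
  also have "\<dots> = (\<Sum>e\<in>loops. 2)" unfolding im using fib by (intro sum.cong) auto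
  finally show ?thesis unfolding Pc_def Pg_def by (simp add: card_cartesian_product)
qed

text \<open>This crude count bounds the error \<open>card loops / card U ^ 2 * \<tau>\<close> in the
  exponent by \<open>(k * D) ^ 2 / (2 * card U)\<close>.\<close>

lemma card_loops_le: "card loops \<le> real (k * D) * real (card U) ^ 2 / 2"
proof -
  have aux: "card {(a, b). a \<in> U \<and> b \<in> U \<and> a \<noteq> b \<and> h a = h b} \<le> card U * K"
    if "\<And>a. a \<in> U \<Longrightarrow> card {b \<in> U. h b = h a} \<le> K" for h :: "'a \<Rightarrow> 'd" and K
  proof -
    have "card {(a, b). a \<in> U \<and> b \<in> U \<and> a \<noteq> b \<and> h a = h b} \<le> card (SIGMA a:U. {b \<in> U. h b = h a})"
      using fin by (intro card_mono) auto
    also have "\<dots> \<le> card U * K"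
      using fin that by (auto simp: card_SigmaI intro!: sum_bounded_above[where K = K, simplified])
    finally show ?thesis .
  qed
  have "2 * card loops \<le> (card U * k) * (card U * D)"
    unfolding card_loops by (intro mult_mono aux card_c card_g) auto
  then have "real (2 * card loops) \<le> real ((card U * k) * (card U * D))" by (simp only: of_nat_le_iff)
  then show ?thesis by (simp add: power2_eq_square mult_ac)
qed

text \<open>From below, every loop costs a factor \<open>1 - \<xi>\<close>; from above,
  \<open>1 - (1 - 8 * \<tau>) / card U ^ 2\<close>. Both have logarithm
  \<open>- (1 + O(\<tau>)) / card U ^ 2\<close>, and over all loops the relative error
  \<open>O(\<tau>)\<close> adds up to the stated one.\<close>

theorem card_avoid_loops_bounds:
  shows "exp (- real (card loops) / real (card U) ^ 2 - 12 * real (k * D) ^ 2 / card U) * fact (card U)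
           \<le> real (card (avoid U loops))"
    and "real (card (avoid U loops))
           \<le> exp (- real (card loops) / real (card U) ^ 2 + 12 * real (k * D) ^ 2 / card U) * fact (card U)"
proof -
  let ?M = "real (card U)" and ?L = "real (card loops)"
  have M: "?M \<ge> 1000" using card_U_ge by simp
  have Lt: "?L / ?M ^ 2 * \<tau> \<le> real (k * D) ^ 2 / (2 * ?M)"
  proof -
    have "?L / ?M ^ 2 \<le> real (k * D) / 2" using card_loops_le M by (simp add: field_simps)
    then have "?L / ?M ^ 2 * \<tau> \<le> real (k * D) / 2 * \<tau>" using \<tau>_bounds by (intro mult_right_mono) auto
    then show ?thesis by (simp add: \<tau>_def power2_eq_square)
  qed
  have "- ?L / ?M ^ 2 - 12 * real (k * D) ^ 2 / ?M \<le> ?L * ln (1 - \<xi>)"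
  proof -
    have "\<xi> ^ 2 \<le> 4 * \<tau> / ?M ^ 2"
    proof -
      have "\<xi> * \<xi> \<le> (2 / ?M ^ 2) * (2 / ?M ^ 2)" using \<xi>_bounds by (intro mult_mono) auto
      also have "\<dots> \<le> (2 / ?M ^ 2) * (2 * \<tau>)"
      proof (intro mult_left_mono)
        have "1 / ?M ^ 2 \<le> 1 / ?M" using M by (simp add: field_simps power2_eq_square)
        then show "2 / ?M ^ 2 \<le> 2 * \<tau>" using \<tau>_bounds(3) by (simp add: field_simps)
      qed auto
      finally show ?thesis by (simp add: power2_eq_square)
    qed
    \<comment> \<open>\<open>24 = 16 + 8\<close>, from the definition of \<open>\<xi>\<close> and
      twice the bound on \<open>\<xi> ^ 2\<close>; the halving in \<open>Lt\<close> makes it the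
      \<open>12\<close> of the statement.\<close>
    then have "\<xi> + 2 * \<xi> ^ 2 \<le> (1 + 24 * \<tau>) / ?M ^ 2" by (simp add: \<xi>_def add_divide_distrib)
    moreover have "- \<xi> - 2 * \<xi> ^ 2 \<le> ln (1 - \<xi>)"
      using \<xi>_bounds by (intro ln_one_minus_pos_lower_bound) auto
    ultimately have "- ((1 + 24 * \<tau>) / ?M ^ 2) \<le> ln (1 - \<xi>)" by linarith
    then have "?L * - ((1 + 24 * \<tau>) / ?M ^ 2) \<le> ?L * ln (1 - \<xi>)" by (intro mult_left_mono) auto
    moreover have "?L * - ((1 + 24 * \<tau>) / ?M ^ 2) = - ?L / ?M ^ 2 - 24 * (?L / ?M ^ 2 * \<tau>)"
      by (simp add: add_divide_distrib algebra_simps)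
    ultimately show ?thesis using Lt by simp
  qed
  then have "exp (- ?L / ?M ^ 2 - 12 * real (k * D) ^ 2 / ?M) \<le> exp (?L * ln (1 - \<xi>))" by simp
  also have "\<dots> = (1 - \<xi>) ^ card loops" using \<xi>_bounds by (simp add: exp_of_nat_mult)
  finally have "exp (- ?L / ?M ^ 2 - 12 * real (k * D) ^ 2 / ?M) * fact (card U)
      \<le> (1 - \<xi>) ^ card loops * fact (card U)" by (intro mult_right_mono) auto
  also have "\<dots> \<le> card (avoid U loops)"
    using card_avoid_ge_power[OF fin finite_loops, of "{}" \<xi>] card_agree_loop_le \<xi>_bounds
      card_permutations[OF refl fin]
    by (simp add: avoid_def) (metis (no_types, lifting) Diff_subset order_trans)
  finally show "exp (- ?L / ?M ^ 2 - 12 * real (k * D) ^ 2 / ?M) * fact (card U) \<le> real (card (avoid U loops))" .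
  have "(1 - (1 - 8 * \<tau>) / ?M ^ 2) ^ card loops \<le> exp (- ((1 - 8 * \<tau>) / ?M ^ 2)) ^ card loops"
  proof (intro power_mono)
    show "1 - (1 - 8 * \<tau>) / ?M ^ 2 \<le> exp (- ((1 - 8 * \<tau>) / ?M ^ 2))"
      using exp_ge_add_one_self[of "- ((1 - 8 * \<tau>) / ?M ^ 2)"] by simp
    have "(1 - 8 * \<tau>) / ?M ^ 2 \<le> 1 / 1" using \<tau>_bounds M by (intro frac_le) auto
    then show "0 \<le> 1 - (1 - 8 * \<tau>) / ?M ^ 2" by simp
  qed
  also have "\<dots> = exp (- ?L / ?M ^ 2 + 8 * (?L / ?M ^ 2 * \<tau>))"
    by (simp add: exp_of_nat_mult[symmetric] diff_divide_distrib algebra_simps)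
  also have "\<dots> \<le> exp (- ?L / ?M ^ 2 + 12 * real (k * D) ^ 2 / ?M)" 
  proof -
    have "real (k * D) ^ 2 / (2 * ?M) = 1 / 2 * (real (k * D) ^ 2 / ?M)" by simp
    moreover have "12 * real (k * D) ^ 2 / ?M = 12 * (real (k * D) ^ 2 / ?M)" by simp
    moreover have "0 \<le> real (k * D) ^ 2 / ?M" by simp
    ultimately have "8 * (?L / ?M ^ 2 * \<tau>) \<le> 12 * real (k * D) ^ 2 / ?M" using Lt by linarith
    then show ?thesis by simp
  qed
  finally have "(1 - (1 - 8 * \<tau>) / ?M ^ 2) ^ card loops * fact (card U)
     \<le> exp (- ?L / ?M ^ 2 + 12 * real (k * D) ^ 2 / ?M) * fact (card U)" by (intro mult_right_mono) auto
  from order_trans[OF card_avoid_loops_le_power[OF finite_loops order_refl] this]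
  show "real (card (avoid U loops))
          \<le> exp (- ?L / ?M ^ 2 + 12 * real (k * D) ^ 2 / ?M) * fact (card U)" .
qed

end

section \<open>Repeated edges\<close>

context labelled_set begin

text \<open>Two edges with \<open>r\<close> common vertices, in a loop-free configuration. The lists
  record which slots of the two edges carry the same vertex. A repeated edge has \<open>k\<close>
  common vertices, so avoiding \<open>shared r\<close> for one \<open>r\<close> between
  \<open>1\<close> and \<open>k\<close> rules it out.\<close>

definition shared :: "nat \<Rightarrow> ('a \<Rightarrow> 'a) set" where
  "shared r = {p \<in> avoid U loops. \<exists>xs ys. length xs = r \<and> length ys = r \<and> distinct (xs @ ys) \<and>
     set (xs @ ys) \<subseteq> U \<and> (\<forall>a\<in>set xs. c a = c (hd xs)) \<and> (\<forall>a\<in>set ys. c a = c (hd ys)) \<and>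
     (\<forall>i<r. g (p (xs ! i)) = g (p (ys ! i)))}"

text \<open>The first slot of a list is free and the others lie in its edge, which gives at most
  \<open>card U * k ^ r\<close> lists; each of the \<open>Suc r\<close> pairs of points at one
  vertex has at most \<open>card U * D\<close> choices. A choice prescribes \<open>2 * Suc r\<close>
  values, and \<open>r \<le> 3\<close> keeps this within eight.\<close>

lemma card_shared_le:
  assumes r: "r \<le> 3"
  shows "card (shared (Suc r))
    \<le> (real (card U) * real k ^ r) ^ 2 * (real (card U) * real D) ^ Suc r
       * (2 / real (card U) ^ (2 * Suc r) * card (avoid U loops))"
proof -
  define L where "L = {xs. length xs = Suc r \<and> set xs \<subseteq> U \<and> (\<forall>a\<in>set xs. c a = c (hd xs))}"
  define Q where "Q = {(u, v). u \<in> U \<and> v \<in> U \<and> g u = g v}"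
  define Z where "Z = {zs. set zs \<subseteq> Q \<and> length zs = Suc r}"
  \<comment> \<open>The slots \<open>xs\<close> get the first and the slots \<open>ys\<close> the
    second components of \<open>zs\<close>.\<close>
  define E where "E = (\<lambda>(xs, ys, zs). set (zip (xs @ ys) (map fst zs @ map snd zs) :: ('a \<times> 'a) list))"
  define I where "I = {(xs, ys, zs) \<in> L \<times> L \<times> Z. distinct (xs @ ys)}"
  have fL: "finite L"
    by (rule finite_subset[OF _ finite_lists_length_eq[OF fin, of "Suc r"]]) (auto simp: L_def)
  have fQ: "finite Q" by (rule finite_subset[of _ "U \<times> U"]) (use fin in \<open>auto simp: Q_def\<close>)
  have fZ: "finite Z" unfolding Z_def using fQ by (rule finite_lists_length_eq)
  have card_L: "card L \<le> card U * k ^ r"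
  proof -
    define W where "W = (SIGMA a:U. {xs. set xs \<subseteq> {b \<in> U. c b = c a} \<and> length xs = r})"
    have fW: "finite {xs. set xs \<subseteq> {b \<in> U. c b = c a} \<and> length xs = r}" for a
      using fin by (intro finite_lists_length_eq) auto
    have "L \<subseteq> (\<lambda>(a, xs). a # xs) ` W"
    proof
      fix xs assume xs: "xs \<in> L"
      then obtain a ys where "xs = a # ys" by (cases xs) (auto simp: L_def)
      then show "xs \<in> (\<lambda>(a, xs). a # xs) ` W"
        using xs by (intro image_eqI[of _ _ "(a, ys)"]) (auto simp: L_def W_def)
    qed
    moreover have "finite W" using fin fW by (auto simp: W_def)
    ultimately have "card L \<le> card W" by (rule surj_card_le[rotated])
    also have "card W = (\<Sum>a\<in>U. card {xs. set xs \<subseteq> {b \<in> U. c b = c a} \<and> length xs = r})"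
      unfolding W_def by (intro card_SigmaI fin ballI fW)
    also have "\<dots> = (\<Sum>a\<in>U. card {b \<in> U. c b = c a} ^ r)"
      using fin by (intro sum.cong card_lists_length_eq) auto
    also have "\<dots> \<le> card U * k ^ r"
      using card_c by (intro sum_bounded_above[where K = "k ^ r", simplified] power_mono) auto
    finally show ?thesis .
  qed
  have card_Q: "card Q \<le> card U * D"
  proof -
    have "Q = (SIGMA u:U. {v \<in> U. g v = g u})" by (auto simp: Q_def)
    then have "card Q = (\<Sum>u\<in>U. card {v \<in> U. g v = g u})" using fin by simp
    also have "\<dots> \<le> card U * D"
      using card_g by (intro sum_bounded_above[where K = D, simplified]) auto
    finally show ?thesis .
  qed
  have sub: "shared (Suc r) \<subseteq> (\<Union>i\<in>I. agree U (E i) \<inter> avoid U loops)"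
  proof
    fix p assume p: "p \<in> shared (Suc r)"
    then obtain xs ys where xy: "length xs = Suc r" "length ys = Suc r" "distinct (xs @ ys)"
      "set (xs @ ys) \<subseteq> U" "\<forall>a\<in>set xs. c a = c (hd xs)" "\<forall>a\<in>set ys. c a = c (hd ys)"
      "\<forall>i<Suc r. g (p (xs ! i)) = g (p (ys ! i))" and pa: "p \<in> avoid U loops"
      unfolding shared_def by blast
    have pU: "p permutes U" using pa avoid_permutes by blast
    define zs where "zs = zip (map p xs) (map p ys)"
    have "zs \<in> Z"
      using xy permutes_in_image[OF pU]
      by (auto simp: Z_def zs_def Q_def in_set_zip subset_iff)
    then have "(xs, ys, zs) \<in> I" using xy by (auto simp: I_def L_def)
    moreover have "p \<in> agree U (E (xs, ys, zs))"
    proof -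
      have "map fst zs @ map snd zs = map p (xs @ ys)" using xy by (simp add: zs_def)
      then show ?thesis using pU by (auto simp: agree_def E_def in_set_zip simp del: map_append)
    qed
    ultimately show "p \<in> (\<Union>i\<in>I. agree U (E i) \<inter> avoid U loops)" using pa by blast
  qed
  have fI: "finite I" by (rule finite_subset[of _ "L \<times> L \<times> Z"]) (use fL fZ in \<open>auto simp: I_def\<close>)
  have EI: "finite (E i) \<and> E i \<subseteq> U \<times> U \<and> card (E i) = 2 * Suc r" if "i \<in> I" for i
  proof -
    obtain xs ys zs where i: "i = (xs, ys, zs)" by (metis surj_pair)
    have *: "length xs = Suc r" "length ys = Suc r" "length zs = Suc r" "distinct (xs @ ys)"
      "set xs \<subseteq> U" "set ys \<subseteq> U" "set zs \<subseteq> Q" using that by (auto simp: i I_def L_def Z_def)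
    let ?zz = "zip (xs @ ys) (map fst zs @ map snd zs)"
    have "distinct ?zz" using *(4) by (rule distinct_zipI1)
    then have "card (set ?zz) = length ?zz" by (rule distinct_card)
    also have "\<dots> = 2 * Suc r" using * by simp
    finally have "card (E i) = 2 * Suc r" by (simp add: E_def i)
    moreover have "E i \<subseteq> set (xs @ ys) \<times> set (map fst zs @ map snd zs)"
      unfolding E_def i prod.case by (meson set_zip_leftD set_zip_rightD subrelI mem_Sigma_iff)
    moreover have "set (xs @ ys) \<subseteq> U" using * by simp
    moreover have "set (map fst zs @ map snd zs) \<subseteq> U" using * by (auto simp: Q_def)
    moreover have "finite (E i)" by (simp add: E_def i)
    ultimately show ?thesis by blast
  qed
  have "card (shared (Suc r)) \<le> real (card I) * (2 / real (card U) ^ (2 * Suc r) * card (avoid U loops))"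
    by (rule card_UN_agree_avoid_le[OF fI EI _ _ sub]) (use r in auto)
  also have "\<dots> \<le> ((real (card U) * real k ^ r) ^ 2 * (real (card U) * real D) ^ Suc r)
      * (2 / real (card U) ^ (2 * Suc r) * card (avoid U loops))"
  proof (intro mult_right_mono)
    have "card I \<le> card (L \<times> L \<times> Z)" using fL fZ by (intro card_mono) (auto simp: I_def)
    also have "\<dots> = card L * (card L * card Q ^ Suc r)"
      using fQ by (simp add: card_cartesian_product Z_def card_lists_length_eq)
    also have "\<dots> \<le> (card U * k ^ r) * ((card U * k ^ r) * (card U * D) ^ Suc r)"
      by (intro mult_mono card_L power_mono card_Q) auto
    finally have "real (card I) \<le> real ((card U * k ^ r) * ((card U * k ^ r) * (card U * D) ^ Suc r))"
      by (simp only: of_nat_le_iff)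
    then show "real (card I) \<le> (real (card U) * real k ^ r) ^ 2 * (real (card U) * real D) ^ Suc r"
      by (simp add: power2_eq_square mult_ac)
  qed auto
  finally show ?thesis .
qed

end

section \<open>Hypergraphs and the configuration model\<close>

lemma nth_concat_uniform:
  assumes "\<forall>u\<in>set ws. length u = k" "i < length ws" "j < k"
  shows "concat ws ! (i * k + j) = ws ! i ! j"
  using assms
proof (induction ws arbitrary: i)
  case (Cons u ws)
  then show ?case by (cases i) (auto simp: nth_append)
qed auto

lemma obtain_chunks:
  assumes "length w = m * k"
  obtains ws where "length ws = m" "\<forall>u\<in>set ws. length u = k" "concat ws = w"
  using assms
proof (induction m arbitrary: w thesis)
  case 0
  then show ?case by (intro 0(1)[of "[]"]) auto
next
  case (Suc m)
  have "length (drop k w) = m * k" using Suc.prems by simp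
  then obtain ws where "length ws = m" "\<forall>u\<in>set ws. length u = k" "concat ws = drop k w"
    using Suc.IH by metis
  then show ?case using Suc.prems(2) by (intro Suc.prems(1)[of "take k w # ws"]) auto
qed

text \<open>All arrangements of \<open>xs\<close> are induced by equally many permutations:
  composition with a fixed \<open>q\<close> that produces \<open>w\<close> is a bijection from the
  stabiliser \<open>F xs\<close> to \<open>F w\<close>.\<close>

lemma card_permute_list_vimage:
  assumes "W \<subseteq> permutations_of_multiset (mset xs)"
  shows "card {p. p permutes {..<length xs} \<and> permute_list p xs \<in> W}
           * card (permutations_of_multiset (mset xs)) = card W * fact (length xs)"
proof -
  let ?M = "{..<length xs}"
  define F where "F w = {p. p permutes ?M \<and> permute_list p xs = w}" for w
  have fF: "finite (F w)" for w
    by (rule finite_subset[OF _ finite_permutations[of ?M]]) (auto simp: F_def)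
  have eq: "card (F w) = card (F xs)" if w: "w \<in> permutations_of_multiset (mset xs)" for w
  proof -
    have "mset w = mset xs" using w by (simp add: permutations_of_multiset_def)
    then obtain q where q: "q permutes ?M" "permute_list q xs = w" by (rule mset_eq_permutation)
    have iq: "inv q permutes ?M" using q(1) by (rule permutes_inv)
    have "bij_betw (\<lambda>p. p \<circ> q) (F xs) (F w)"
    proof (rule bij_betwI[where g = "\<lambda>p. p \<circ> inv q"])
      show "(\<lambda>p. p \<circ> q) \<in> F xs \<rightarrow> F w"
        using q by (auto simp: F_def permutes_compose permute_list_compose)
      show "(\<lambda>p. p \<circ> inv q) \<in> F w \<rightarrow> F xs"
      proof
        fix p assume "p \<in> F w"
        then have p: "p permutes ?M" "permute_list p xs = permute_list q xs" using q by (auto simp: F_def)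
        have "permute_list (p \<circ> inv q) xs = permute_list (q \<circ> inv q) xs"
          using iq p by (simp add: permute_list_compose)
        then show "p \<circ> inv q \<in> F xs"
          using iq p permutes_inv_o[OF q(1)] by (simp add: F_def permutes_compose)
      qed
    qed (auto simp: o_assoc[symmetric] permutes_inv_o[OF q(1)])
    then show ?thesis by (simp add: bij_betw_same_card)
  qed
  have vim: "card {p. p permutes ?M \<and> permute_list p xs \<in> V} = card V * card (F xs)"
    if V: "V \<subseteq> permutations_of_multiset (mset xs)" for V
  proof -
    have "{p. p permutes ?M \<and> permute_list p xs \<in> V} = (\<Union>w\<in>V. F w)" by (auto simp: F_def)
    also have "card \<dots> = (\<Sum>w\<in>V. card (F w))"
      using V finite_subset[OF V] fF by (intro card_UN_disjoint) (auto simp: F_def)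
    also have "\<dots> = card V * card (F xs)" using V eq by (simp add: subset_iff)
    finally show ?thesis .
  qed
  have "{p. p permutes ?M \<and> permute_list p xs \<in> permutations_of_multiset (mset xs)} = {p. p permutes ?M}"
    by (auto simp: permutations_of_multiset_def)
  then have "fact (length xs) = card (permutations_of_multiset (mset xs)) * card (F xs)"
    using vim[of "permutations_of_multiset (mset xs)"] card_permutations[of ?M "length xs"] by simp
  then show ?thesis using vim[OF assms] by simp
qed

text \<open>A hypergraph with an order of its edges and of the vertices in every edge; concatenated,
  it becomes a word over the vertices.\<close>

definition orderings :: "'a set set set \<Rightarrow> 'a list list set" where
  "orderings H = {ws. (\<forall>u\<in>set ws. distinct u) \<and> distinct (map set ws) \<and> set (map set ws) \<in> H}"

lemma card_edge_orderings:
  assumes "\<forall>e\<in>set es. finite e"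
  shows "finite {ws. map set ws = es \<and> (\<forall>u\<in>set ws. distinct u)} \<and>
    card {ws. map set ws = es \<and> (\<forall>u\<in>set ws. distinct u)} = (\<Prod>e\<leftarrow>es. fact (card e))"
  using assms
proof (induction es)
  case Nil
  have *: "{ws. map set ws = [] \<and> (\<forall>u\<in>set ws. distinct u)} = {[]}" by auto
  show ?case unfolding * by simp
next
  case (Cons e es)
  define B where "B = {ws. map set ws = es \<and> (\<forall>u\<in>set ws. distinct u)}"
  have "{ws. map set ws = e # es \<and> (\<forall>u\<in>set ws. distinct u)}
      = (\<lambda>(u, ws). u # ws) ` (permutations_of_set e \<times> B)" (is "?L = ?R")
  proof
    show "?L \<subseteq> ?R"
    proof
      fix ws assume "ws \<in> ?L"
      then obtain u ws' where "ws = u # ws'" "set u = e" "distinct u" "ws' \<in> B"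
        by (cases ws) (auto simp: B_def)
      then show "ws \<in> ?R" by (intro image_eqI[of _ _ "(u, ws')"]) auto
    qed
    show "?R \<subseteq> ?L" by (auto simp: B_def dest: permutations_of_setD)
  qed
  moreover have "inj_on (\<lambda>(u, ws). u # ws) (permutations_of_set e \<times> B)" by (auto simp: inj_on_def)
  moreover have "finite B" "card B = (\<Prod>e\<leftarrow>es. fact (card e))"
    using Cons unfolding B_def by auto
  ultimately show ?case using Cons.prems by (simp add: card_image card_cartesian_product)
qed

text \<open>There are \<open>fact m\<close> orders of the edges, and \<open>fact k\<close> orders
  inside each of the \<open>m\<close> edges.\<close>

lemma card_orderings:
  assumes fH: "finite H" and H: "\<And>E. E \<in> H \<Longrightarrow> finite E \<and> card E = m \<and> (\<forall>e\<in>E. finite e \<and> card e = k)"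
  shows "card (orderings H) = card H * fact m * fact k ^ m"
proof -
  define B where "B es = {ws. map set ws = es \<and> (\<forall>u\<in>set ws. distinct u)}" for es :: "'a set list"
  define ES where "ES = (\<Union>E\<in>H. permutations_of_set E)"
  have "finite ES" using fH by (auto simp: ES_def)
  have "card ES = (\<Sum>E\<in>H. card (permutations_of_set E))"
    unfolding ES_def using fH by (intro card_UN_disjoint) (auto dest: permutations_of_setD)
  also have "\<dots> = card H * fact m" using H by simp
  finally have ES: "card ES = card H * fact m" .
  have B: "finite (B es) \<and> card (B es) = fact k ^ m" if es: "es \<in> ES" for es
  proof -
    obtain E where E: "E \<in> H" "set es = E" "distinct es"
      using es unfolding ES_def permutations_of_set_def by blast
    have "length es = m" using E H distinct_card[of es] by auto
    moreover have "map (\<lambda>e. fact (card e) :: nat) es = map (\<lambda>_. fact k) es" using E H by auto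
    ultimately have "(\<Prod>e\<leftarrow>es. fact (card e)) = (fact k ^ m :: nat)"
      by (simp add: map_replicate_const)
    then show ?thesis using card_edge_orderings[of es] E H unfolding B_def by auto
  qed
  have "orderings H = (\<Union>es\<in>ES. B es)"
    by (auto simp: orderings_def ES_def B_def permutations_of_set_def)
  also have "card \<dots> = (\<Sum>es\<in>ES. card (B es))"
    using \<open>finite ES\<close> B by (intro card_UN_disjoint) (auto simp: B_def)
  also have "\<dots> = card ES * fact k ^ m" using B by simp
  finally show ?thesis using ES by simp
qed

text \<open>Blocks are repetition-free, so an occurrence of \<open>v\<close> in the word is an edge
  containing \<open>v\<close>; distinctness of the edges makes list and set agree.\<close>

lemma count_concat_eq_deg:
  assumes "\<forall>u\<in>set ws. distinct u" "distinct (map set ws)"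
  shows "count (mset (concat ws)) v = deg (set (map set ws)) v"
proof -
  have "count (mset (concat ws)) v = (\<Sum>u\<leftarrow>ws. if v \<in> set u then 1 else 0)"
    using assms(1) by (induction ws) (auto simp: distinct_count_atmost_1)
  also have "\<dots> = (\<Sum>e\<leftarrow>map set ws. if v \<in> e then 1 else 0)" by (simp add: comp_def)
  also have "\<dots> = (\<Sum>e\<in>set (map set ws). if v \<in> e then 1 else 0)"
    by (rule sum_list_distinct_conv_sum_set[OF assms(2)])
  also have "\<dots> = deg (set (map set ws)) v"
    by (simp add: deg_def sum.If_cases Int_def)
  finally show ?thesis .
qed

text \<open>The entry \<open>xs ! u\<close> is the vertex of the point \<open>u\<close>; a vertex
  \<open>v\<close> owns \<open>d v\<close> points.\<close>

locale degree_list =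
  fixes n k m :: nat and d :: "nat \<Rightarrow> int" and xs :: "nat list"
  assumes k: "k \<ge> 1" and set_xs: "set xs \<subseteq> {1..n}" and len: "length xs = m * k"
    and count_xs: "\<And>v. v \<in> {1..n} \<Longrightarrow> int (count (mset xs) v) = d v"
begin

definition H :: "nat set set set" where
  "H = {E \<in> kgraphs n k m. has_degseq n E d}"

text \<open>\<open>permute_list p xs\<close> has \<open>xs ! p a\<close> at position
  \<open>a\<close>: the vertex that the configuration puts in slot \<open>a\<close>. Slots
  \<open>i * k\<close> to \<open>i * k + k - 1\<close> form edge \<open>i\<close>.\<close>

definition simple :: "(nat \<Rightarrow> nat) set" where
  "simple = {p. p permutes {..<m * k} \<and> permute_list p xs \<in> concat ` orderings H}"

lemma H_D:
  assumes "E \<in> H"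
  shows "finite E \<and> card E = m \<and> (\<forall>e\<in>E. finite e \<and> card e = k \<and> e \<subseteq> {1..n})"
proof -
  have "E \<subseteq> {e. e \<subseteq> {1..n} \<and> card e = k}" "card E = m"
    using assms by (auto simp: H_def kgraphs_def)
  moreover have "finite {e. e \<subseteq> {1..n} \<and> card e = k}" by (rule finite_subset[of _ "Pow {1..n}"]) auto
  ultimately show ?thesis using finite_subset[of _ "{1..n}"] by (auto intro: finite_subset)
qed

lemma finite_H: "finite H"
  by (rule finite_subset[of _ "Pow (Pow {1..n})"]) (auto simp: H_def kgraphs_def)

lemma orderings_H_D:
  assumes "ws \<in> orderings H"
  shows "length ws = m" "\<forall>u\<in>set ws. length u = k \<and> distinct u" "mset (concat ws) = mset xs"
proof -
  have ws: "\<forall>u\<in>set ws. distinct u" "distinct (map set ws)" "set (map set ws) \<in> H"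
    using assms by (auto simp: orderings_def)
  show "length ws = m" using H_D[OF ws(3)] distinct_card[OF ws(2)] by simp
  show "\<forall>u\<in>set ws. length u = k \<and> distinct u" using H_D[OF ws(3)] ws(1) by (auto simp: distinct_card)
  show "mset (concat ws) = mset xs"
  proof (rule multiset_eqI)
    fix v
    show "count (mset (concat ws)) v = count (mset xs) v"
    proof (cases "v \<in> {1..n}")
      case True
      then have "int (deg (set (map set ws)) v) = d v" using ws(3) unfolding H_def has_degseq_def by blast
      then show ?thesis using count_concat_eq_deg[OF ws(1,2), of v] count_xs[OF True] by simp
    next
      case False
      then have "v \<notin> set xs" using set_xs by auto
      moreover have "v \<notin> set (concat ws)" using H_D[OF ws(3)] False unfolding set_concat set_map by blast
      ultimately show ?thesis by (metis count_mset_0_iff)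
    qed
  qed
qed

text \<open>Every hypergraph in \<open>H\<close> arises from the same number of configurations,
  given by the orders of the edges, the orders within edges and the orders of the points at each
  vertex. The last factor comes from the multinomial count of arrangements.\<close>

lemma card_simple:
  "card simple = card H * fact m * fact k ^ m * (\<Prod>v\<in>{1..n}. fact (nat (d v)))"
proof -
  let ?P = "permutations_of_multiset (mset xs)"
  have sub: "concat ` orderings H \<subseteq> ?P"
    using orderings_H_D(3) by (auto simp: permutations_of_multiset_def)
  have "inj_on concat (orderings H)"
  proof (rule inj_onI)
    fix ws ws' assume ws: "ws \<in> orderings H" "ws' \<in> orderings H" "concat ws = concat ws'"
    show "ws = ws'"
    proof (rule concat_injective[OF ws(3)])
      show "\<forall>(x, y)\<in>set (zip ws ws'). length x = length y"
      proof clarify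
        fix x y assume "(x, y) \<in> set (zip ws ws')"
        then have "x \<in> set ws" "y \<in> set ws'" by (rule set_zip_leftD, rule set_zip_rightD)
        then show "length x = length y"
          using orderings_H_D(2)[OF ws(1)] orderings_H_D(2)[OF ws(2)] by simp
      qed
    qed (use orderings_H_D(1) ws in auto)
  qed
  then have card_W: "card (concat ` orderings H) = card H * fact m * fact k ^ m"
    using card_orderings[OF finite_H, of m k] H_D by (simp add: card_image)
  have prod_eq: "(\<Prod>v\<in>set_mset (mset xs). fact (count (mset xs) v)) = (\<Prod>v\<in>{1..n}. fact (nat (d v)) :: nat)"
  proof (rule prod.mono_neutral_cong_left)
    show "\<forall>v\<in>{1..n} - set_mset (mset xs). fact (nat (d v)) = (1 :: nat)"
    proof
      fix v assume v: "v \<in> {1..n} - set_mset (mset xs)"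
      then have "count (mset xs) v = 0" by (simp add: count_mset_0_iff)
      then have "d v = 0" using count_xs[of v] v by (metis DiffD1 of_nat_0)
      then show "fact (nat (d v)) = (1 :: nat)" by simp
    qed
    show "fact (count (mset xs) v) = (fact (nat (d v)) :: nat)" if "v \<in> set_mset (mset xs)" for v
      using count_xs[of v] that set_xs by (metis nat_int set_mset_mset subsetD)
  qed (use set_xs in auto)
  have "card simple * card ?P = card H * fact m * fact k ^ m * fact (m * k)"
    using card_permute_list_vimage[OF sub] by (simp add: simple_def len card_W)
  moreover have "card ?P * (\<Prod>v\<in>{1..n}. fact (nat (d v))) = fact (m * k)"
    using card_permutations_of_multiset[of "mset xs"] prod_eq by (simp add: len)
  ultimately have "card simple * fact (m * k)
      = card H * fact m * fact k ^ m * (\<Prod>v\<in>{1..n}. fact (nat (d v))) * fact (m * k)"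
    by (metis (no_types, lifting) mult.assoc mult.commute)
  then show ?thesis by simp
qed

lemma card_cell:
  assumes "a < m * k"
  shows "card {b \<in> {..<m * k}. b div k = a div k} = k"
proof -
  have "{b \<in> {..<m * k}. b div k = a div k} = {(a div k) * k..<(a div k) * k + k}"
  proof (intro equalityI subsetI)
    fix b assume "b \<in> {b \<in> {..<m * k}. b div k = a div k}"
    moreover have "b mod k < k" using k by simp
    ultimately show "b \<in> {(a div k) * k..<(a div k) * k + k}"
      using div_mult_mod_eq[of b k] unfolding atLeastLessThan_iff by auto
  next
    fix b assume b: "b \<in> {(a div k) * k..<(a div k) * k + k}"
    then obtain j where j: "b = a div k * k + j" "j < k"
      by (intro that[of "b - a div k * k"]) auto
    then have "b div k = a div k" by simp
    moreover have "a div k < m" using assms k by (simp add: div_less_iff_less_mult)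
    ultimately have "b div k < m" by simp
    then have "b < m * k" using k by (simp add: div_less_iff_less_mult)
    then show "b \<in> {b \<in> {..<m * k}. b div k = a div k}" using \<open>b div k = a div k\<close> by simp
  qed
  then show ?thesis by simp
qed

lemma card_fibre:
  "card {b \<in> {..<m * k}. xs ! b = xs ! a} = count (mset xs) (xs ! a)"
  by (simp add: count_mset count_list_eq_length_filter length_filter_conv_card len) metis

end

locale degree_list_small = degree_list +
  fixes D :: nat
  assumes m: "m \<ge> 1" and d_le: "\<And>v. v \<in> {1..n} \<Longrightarrow> d v \<le> int D"
    and kD: "1000 * (k * D) \<le> m * k"
begin

text \<open>Slot \<open>a\<close> belongs to edge \<open>a div k\<close> and point \<open>u\<close>
  to vertex \<open>xs ! u\<close>.\<close>

sublocale labelled_set "{..<m * k}" "\<lambda>a. a div k" "\<lambda>u. xs ! u" k D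
proof
  show "card {b \<in> {..<m * k}. b div k = a div k} \<le> k" if "a \<in> {..<m * k}" for a
    using card_cell that by simp
  show "card {b \<in> {..<m * k}. xs ! b = xs ! a} \<le> D" if "a \<in> {..<m * k}" for a
  proof -
    have "xs ! a \<in> set xs" using that len by simp
    then have "xs ! a \<in> {1..n}" using set_xs by blast
    then show ?thesis using card_fibre[of a] count_xs[of "xs ! a"] d_le[of "xs ! a"] by linarith
  qed
  have "0 < m * k" using m k by simp
  then show "{..<m * k} \<noteq> {}" by blast
qed (use kD in auto)


text \<open>A loop would put one vertex into two positions of an edge, but the blocks of an ordering
  are repetition-free.\<close>

lemma simple_subset_avoid: "simple \<subseteq> avoid {..<m * k} loops"
proof
  fix p assume "p \<in> simple"
  then obtain ws where p: "p permutes {..<m * k}" and ws: "ws \<in> orderings H" "permute_list p xs = concat ws"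
    by (auto simp: simple_def)
  have val: "xs ! p a = ws ! (a div k) ! (a mod k) \<and> a div k < m \<and> a mod k < k" if "a < m * k" for a
  proof -
    have *: "a div k < m" "a mod k < k" using that k by (auto simp: less_mult_imp_div_less)
    have "xs ! p a = concat ws ! (a div k * k + a mod k)"
      using permute_list_nth[of p xs a] p that by (simp add: len flip: ws(2))
    also have "\<dots> = ws ! (a div k) ! (a mod k)"
      using orderings_H_D[OF ws(1)] * by (intro nth_concat_uniform) auto
    finally show ?thesis using * by simp
  qed
  have "p \<notin> agree {..<m * k} e" if el: "e \<in> loops" for e
  proof
    assume pe: "p \<in> agree {..<m * k} e"
    obtain a u b v where e': "e = {(a, u), (b, v)}" "{a, b, u, v} \<subseteq> {..<m * k}" "a \<noteq> b"
        "a div k = b div k" "xs ! u = xs ! v"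
      using el unfolding loops_def by blast
    then have e: "e = {(a, u), (b, v)}" "a < m * k" "b < m * k" "a \<noteq> b"
        "a div k = b div k" "xs ! u = xs ! v" by auto
    have "p a = u" "p b = v" using pe e(1) by (auto intro: agreeD)
    then have eq: "ws ! (a div k) ! (a mod k) = ws ! (a div k) ! (b mod k)" using val e by metis
    have "ws ! (a div k) \<in> set ws" using val[OF e(2)] orderings_H_D(1)[OF ws(1)] by simp
    then have "distinct (ws ! (a div k))" "length (ws ! (a div k)) = k"
      using orderings_H_D(2)[OF ws(1)] by auto
    then have "a mod k = b mod k" using eq val e by (metis nth_eq_iff_index_eq)
    then show False using e by (metis div_mult_mod_eq)
  qed
  then show "p \<in> avoid {..<m * k} loops" using p by (auto simp: avoid_def)
qed

text \<open>Without loops every block of the word is repetition-free. Two blocks with the same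
  vertex set would give \<open>r\<close> matched slots and put \<open>p\<close> into
  \<open>shared r\<close>, so the blocks form a hypergraph; its degrees are the multiplicities in
  \<open>xs\<close>.\<close>

lemma avoid_subset_simple:
  assumes r: "1 \<le> r" "r \<le> k"
  shows "avoid {..<m * k} loops - shared r \<subseteq> simple"
proof
  fix p assume p: "p \<in> avoid {..<m * k} loops - shared r"
  then have pU: "p permutes {..<m * k}" by (auto dest: avoid_permutes)
  have pm: "mset (permute_list p xs) = mset xs" using pU by (simp add: len)
  have "length (permute_list p xs) = m * k" by (simp add: len)
  then obtain ws where ws: "length ws = m" "\<forall>u\<in>set ws. length u = k" "concat ws = permute_list p xs"
    by (rule obtain_chunks)
  have lt: "i * k + j < m * k" if "i < m" "j < k" for i j
  proof -
    have "i * k + j < i * k + k" using that by simp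
    also have "\<dots> = Suc i * k" by simp
    also have "\<dots> \<le> m * k" using that by (intro mult_right_mono) auto
    finally show ?thesis .
  qed
  have divk: "(i * k + j) div k = i" if "j < k" for i j using that by simp
  have val: "ws ! i ! j = xs ! p (i * k + j)" if "i < m" "j < k" for i j
    using nth_concat_uniform[OF ws(2), of i j] permute_list_nth[of p xs "i * k + j"] pU lt[OF that]
    by (simp add: ws len that)
  have lenw: "length (ws ! i) = k" if "i < m" for i using ws that by simp
  have dist: "distinct (ws ! i)" if i: "i < m" for i
    unfolding distinct_conv_nth lenw[OF i]
  proof (intro allI impI notI)
    fix j j' assume j: "j < k" "j' < k" "j \<noteq> j'" "ws ! i ! j = ws ! i ! j'"
    define a b where "a = i * k + j" and "b = i * k + j'"
    have ab: "a < m * k" "b < m * k" "a \<noteq> b" "a div k = b div k" "xs ! p a = xs ! p b"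
      using j i lt val divk by (auto simp: a_def b_def)
    have pab: "{a, b, p a, p b} \<subseteq> {..<m * k}" "p a \<noteq> p b"
      using ab(1-3) permutes_in_image[OF pU] permutes_inj[OF pU] by (auto simp: inj_eq)
    have "{(a, p a), (b, p b)} \<in> loops"
      unfolding loops_def by (rule CollectI, intro exI conjI, rule refl) (use ab pab in simp_all)
    moreover have "p \<in> agree {..<m * k} {(a, p a), (b, p b)}" using pU by (auto simp: agree_def)
    ultimately show False using p by (auto simp: avoid_def)
  qed
  have dist2: "distinct (map set ws)"
    unfolding distinct_conv_nth
  proof (intro allI impI notI)
    fix i i' assume i: "i < length (map set ws)" "i' < length (map set ws)" "i \<noteq> i'"
        "map set ws ! i = map set ws ! i'"
    then have im: "i < m" "i' < m" and eq: "set (ws ! i) = set (ws ! i')" using ws by auto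
    have "\<exists>j'<k. ws ! i' ! j' = ws ! i ! j" if "j < k" for j
      using that eq lenw im nth_mem[of j "ws ! i"] by (metis in_set_conv_nth)
    \<comment> \<open>\<open>h j\<close> is the position in edge \<open>i'\<close> of the vertex at
      position \<open>j\<close> of edge \<open>i\<close>; the first \<open>r\<close> positions
      provide the two lists of slots.\<close>
    then obtain h where h: "\<And>j. j < k \<Longrightarrow> h j < k \<and> ws ! i' ! h j = ws ! i ! j" by metis
    have hinj: "j = j'" if "j < k" "j' < k" "h j = h j'" for j j'
      using h[OF that(1)] h[OF that(2)] that dist[OF im(1)] lenw[OF im(1)]
      by (metis nth_eq_iff_index_eq)
    define as where "as = map (\<lambda>j. i * k + j) [0..<r]"
    define bs where "bs = map (\<lambda>j. i' * k + h j) [0..<r]"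
    have div: "a div k = i" if a: "a \<in> set as" for a
    proof -
      obtain j where "a = i * k + j" "j < r" using a by (auto simp: as_def intro: that[of "a - i * k"])
      then show ?thesis using divk r by simp
    qed
    have div': "b div k = i'" if "b \<in> set bs" for b using that r divk h by (auto simp: bs_def)
    have ne: "as \<noteq> []" "bs \<noteq> []" using r by (auto simp: as_def bs_def)
    have "set as \<inter> set bs = {}" using div div' i(3) by blast
    moreover have "distinct as" by (auto simp: as_def distinct_map inj_on_def)
    moreover have "distinct bs" using r hinj by (auto simp: bs_def distinct_map inj_on_def)
    ultimately have "distinct (as @ bs)" by simp
    moreover have "set (as @ bs) \<subseteq> {..<m * k}" 
    proof
      fix a assume "a \<in> set (as @ bs)"
      then have "a div k < m" using div div' im by auto
      then show "a \<in> {..<m * k}" using k by (simp add: div_less_iff_less_mult)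
    qed
    moreover have "\<forall>a\<in>set as. a div k = hd as div k" "\<forall>a\<in>set bs. a div k = hd bs div k"
      using div div' ne by auto
    moreover have "xs ! p (as ! j) = xs ! p (bs ! j)" if "j < r" for j
      using that r h[of j] val[of i j] val[of i' "h j"] im by (simp add: as_def bs_def)
    moreover have "length as = r" "length bs = r" by (auto simp: as_def bs_def)
    ultimately have "p \<in> shared r" using p unfolding shared_def by blast
    then show False using p by blast
  qed
  have dist1: "\<forall>u\<in>set ws. distinct u" using dist ws(1) by (auto simp: in_set_conv_nth)
  have "set (map set ws) \<in> H"
  proof -
    have "set (concat ws) = set xs" unfolding ws(3) using pm by (metis set_mset_mset)
    then have "\<forall>u\<in>set ws. set u \<subseteq> {1..n}" using set_xs by auto
    moreover have "\<forall>u\<in>set ws. card (set u) = k" using dist1 ws(2) by (auto simp: distinct_card)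
    moreover have "card (set (map set ws)) = m" using distinct_card[OF dist2] ws(1) by simp
    moreover have "int (deg (set (map set ws)) v) = d v" if "v \<in> {1..n}" for v
      using count_concat_eq_deg[OF dist1 dist2, of v] count_xs[OF that] pm ws(3) by simp
    ultimately show ?thesis by (auto simp: H_def kgraphs_def has_degseq_def)
  qed
  then have "ws \<in> orderings H" using dist1 dist2 by (simp add: orderings_def)
  then show "p \<in> simple" using pU ws(3) by (auto simp: simple_def intro: image_eqI[of _ _ ws])
qed

end

section \<open>The number of loops in terms of the degrees\<close>

lemma card_pairs:
  fixes h :: "nat \<Rightarrow> 'x"
  shows "card {(a, b). a \<in> {..<N} \<and> b \<in> {..<N} \<and> a \<noteq> b \<and> h a = h b}
           = (\<Sum>a<N. card {b \<in> {..<N}. h b = h a} - 1)"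
proof -
  have "{(a, b). a \<in> {..<N} \<and> b \<in> {..<N} \<and> a \<noteq> b \<and> h a = h b}
      = (SIGMA a:{..<N}. {b \<in> {..<N}. h b = h a} - {a})" by auto
  also have "card \<dots> = (\<Sum>a<N. card ({b \<in> {..<N}. h b = h a} - {a}))"
    by (intro card_SigmaI) auto
  also have "\<dots> = (\<Sum>a<N. card {b \<in> {..<N}. h b = h a} - 1)"
    by (intro sum.cong) (auto simp: card_Diff_singleton)
  finally show ?thesis .
qed

context degree_list_small begin

text \<open>The expected number of loops, up to replacing the probability
  \<open>1 / (M (M - 1))\<close> of a loop by \<open>1 / M ^ 2\<close> for
  \<open>M = m * k\<close>.\<close>

definition lam :: real where
  "lam = (real k - 1) / (2 * real (m * k)) * (\<Sum>v\<in>{1..n}. real_of_int (d v) * (real_of_int (d v) - 1))"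

lemma card_loops_eq: "real (card loops) / real (m * k) ^ 2 = lam"
proof -
  have "real (2 * card loops) = real ((\<Sum>a<m * k. k - 1) * (\<Sum>u<m * k. count (mset xs) (xs ! u) - 1))"
    unfolding card_loops card_pairs card_fibre
    by (rule arg_cong[where f = "\<lambda>c. real (c * _)"], rule sum.cong) (use card_cell in auto)
  also have "(\<Sum>u<m * k. count (mset xs) (xs ! u) - 1) = (\<Sum>u\<leftarrow>xs. count (mset xs) u - 1)"
    by (simp add: sum_list_sum_nth len atLeast0LessThan)
  \<comment> \<open>Grouping the points by vertex turns \<open>d v - 1\<close> per point into
    \<open>d v * (d v - 1)\<close> per vertex.\<close>
  also have "\<dots> = (\<Sum>v\<in>set xs. count (mset xs) v * (count (mset xs) v - 1))"
    by (simp add: sum_list_map_eq_sum_count count_mset count_list_eq_length_filter)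
  also have "\<dots> = (\<Sum>v\<in>{1..n}. count (mset xs) v * (count (mset xs) v - 1))"
    using set_xs by (intro sum.mono_neutral_left) (auto simp: count_mset_0_iff)
  finally have "2 * real (card loops) = real (m * k) * real (k - 1)
      * (\<Sum>v\<in>{1..n}. real (count (mset xs) v * (count (mset xs) v - 1)))"
    by simp
  also have "(\<Sum>v\<in>{1..n}. real (count (mset xs) v * (count (mset xs) v - 1)))
      = (\<Sum>v\<in>{1..n}. real_of_int (d v) * (real_of_int (d v) - 1))"
  proof (intro sum.cong refl)
    fix v assume "v \<in> {1..n}"
    then have "d v = int (count (mset xs) v)" using count_xs by simp
    then show "real (count (mset xs) v * (count (mset xs) v - 1))
        = real_of_int (d v) * (real_of_int (d v) - 1)"
      by (cases "count (mset xs) v") (auto simp: algebra_simps)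
  qed
  finally have "real (card loops) = real (m * k) * (real k - 1) / 2
      * (\<Sum>v\<in>{1..n}. real_of_int (d v) * (real_of_int (d v) - 1))"
    using k by (simp add: of_nat_diff)
  then show ?thesis using k m by (simp add: lam_def power2_eq_square field_simps)
qed

lemma card_avoid_loops:
  "exp (- lam - 12 * (real k * real D ^ 2 / real m)) * fact (m * k) \<le> real (card (avoid {..<m * k} loops))"
  "real (card (avoid {..<m * k} loops)) \<le> exp (- lam + 12 * (real k * real D ^ 2 / real m)) * fact (m * k)"
proof -
  have 1: "12 * real (k * D) ^ 2 / real (card {..<m * k}) = 12 * (real k * real D ^ 2 / real m)"
    using k m by (simp add: field_simps power2_eq_square)
  have 2: "- real (card loops) / real (card {..<m * k}) ^ 2 = - lam"
    using card_loops_eq by simp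
  have 3: "fact (card {..<m * k}) = (fact (m * k) :: real)" by simp
  show "exp (- lam - 12 * (real k * real D ^ 2 / real m)) * fact (m * k) \<le> real (card (avoid {..<m * k} loops))"
    "real (card (avoid {..<m * k} loops)) \<le> exp (- lam + 12 * (real k * real D ^ 2 / real m)) * fact (m * k)"
    using card_avoid_loops_bounds unfolding 1 2 3 by blast+
qed

theorem card_simple_upper:
  "card simple \<le> exp (- lam + 12 * (real k * real D ^ 2 / real m)) * fact (m * k)"
proof -
  have "card simple \<le> card (avoid {..<m * k} loops)"
    using simple_subset_avoid by (intro card_mono) auto
  then show ?thesis using card_avoid_loops(2) by linarith
qed

text \<open>By \<open>card_shared_le\<close>, \<open>\<beta>\<close> bounds the conditional
  probability of \<open>shared r\<close> given that there are no loops.\<close>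

theorem card_simple_lower:
  assumes "1 \<le> r" "r \<le> 4" "r \<le> k"
    and \<beta>: "2 * (real (m * k) * real k ^ (r - 1)) ^ 2 * (real (m * k) * real D) ^ r / real (m * k) ^ (2 * r) \<le> \<beta>"
    and "\<beta> \<le> 1"
  shows "(1 - \<beta>) * (exp (- lam - 12 * (real k * real D ^ 2 / real m)) * fact (m * k)) \<le> card simple"
proof -
  let ?A = "real (card (avoid {..<m * k} loops))"
  obtain r' where r': "r = Suc r'" using assms(1) by (cases r) auto
  have "card (shared r) \<le> (real (m * k) * real k ^ r') ^ 2 * (real (m * k) * real D) ^ Suc r'
       * (2 / real (m * k) ^ (2 * Suc r') * ?A)"
    using card_shared_le[of r'] assms(2) by (simp add: r')
  also have "\<dots> = 2 * (real (m * k) * real k ^ (r - 1)) ^ 2 * (real (m * k) * real D) ^ r / real (m * k) ^ (2 * r) * ?A"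
    by (simp add: r' mult_ac)
  also have "\<dots> \<le> \<beta> * ?A" by (intro mult_right_mono \<beta>) auto
  finally have s: "card (shared r) \<le> \<beta> * ?A" .
  have "card (avoid {..<m * k} loops) - card (shared r) \<le> card (avoid {..<m * k} loops - shared r)"
    by (intro diff_card_le_card_Diff) (auto simp: shared_def intro: finite_subset[of _ "avoid {..<m * k} loops"])
  also have "\<dots> \<le> card simple"
  proof (rule card_mono[OF _ avoid_subset_simple])
    show "finite simple" by (rule finite_subset[OF simple_subset_avoid]) simp
  qed (use assms in auto)
  finally have "?A - card (shared r) \<le> card simple" by linarith
  then have 1: "(1 - \<beta>) * ?A \<le> card simple" using s by (simp add: left_diff_distrib)
  have "(1 - \<beta>) * (exp (- lam - 12 * (real k * real D ^ 2 / real m)) * fact (m * k)) \<le> (1 - \<beta>) * ?A"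
    using \<open>\<beta> \<le> 1\<close> by (intro mult_left_mono card_avoid_loops(1)) auto
  with 1 show ?thesis by linarith
qed

end

section \<open>Falling factorials and the final estimate\<close>

definition ffall :: "nat \<Rightarrow> nat \<Rightarrow> real" where
  "ffall a r = (\<Prod>i<r. real a - real i)"

lemma binomial_ffall: "real (a choose r) * fact r = ffall a r"
  by (simp add: binomial_gbinomial gbinomial_prod_rev ffall_def atLeast0LessThan)

lemma ffall_nonneg: "r \<le> a \<Longrightarrow> 0 \<le> ffall a r"
  by (auto simp: ffall_def intro!: prod_nonneg)

lemma sum_lessThan_div: "(\<Sum>i<r. real i / a) = real r * (real r - 1) / (2 * a)"
proof -
  have 2: "2 * (\<Sum>i<r. real i) = real r * (real r - 1)"
    by (induction r) (auto simp: algebra_simps)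
  have "(\<Sum>i<r. real i / a) = 2 * (\<Sum>i<r. real i) / (2 * a)" by (simp add: sum_divide_distrib)
  then show ?thesis by (simp only: 2)
qed

text \<open>Factorwise \<open>1 - y \<le> exp (- y)\<close>.\<close>

lemma ffall_le:
  assumes "r \<le> a" "a > 0"
  shows "ffall a r \<le> real a ^ r * exp (- (real r * (real r - 1) / (2 * real a)))"
proof -
  have "ffall a r \<le> (\<Prod>i<r. real a * exp (- (real i / a)))"
    unfolding ffall_def
  proof (intro prod_mono conjI)
    fix i assume "i \<in> {..<r}"
    then show "0 \<le> real a - real i" using assms by auto
    have "real a * (1 + - (real i / a)) \<le> real a * exp (- (real i / a))"
      by (intro mult_left_mono exp_ge_add_one_self) auto
    then show "real a - real i \<le> real a * exp (- (real i / a))" using assms by (simp add: right_diff_distrib)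
  qed
  also have "\<dots> = real a ^ r * exp (\<Sum>i<r. - (real i / a))"
    by (simp add: prod.distrib exp_sum)
  also have "(\<Sum>i<r. - (real i / a)) = - (real r * (real r - 1) / (2 * real a))"
    by (simp add: sum_negf sum_lessThan_div)
  finally show ?thesis .
qed

lemma ffall_le_power: "r \<le> a \<Longrightarrow> ffall a r \<le> real a ^ r"
proof -
  assume "r \<le> a"
  then have "ffall a r \<le> (\<Prod>i<r. real a)" unfolding ffall_def by (intro prod_mono) auto
  then show ?thesis by simp
qed

text \<open>Two precisions: the first bound keeps the exact second-order term and serves for
  \<open>n choose k\<close>, where that term contributes to the main exponent; the second serves
  where \<open>r ^ 2 / a\<close> is an error. The condition \<open>2 * r \<le> a\<close> keeps all
  \<open>i / a\<close> at most \<open>1 / 2\<close>, where the bounds on the logarithm hold.\<close>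

lemma ffall_ge:
  assumes "2 * r \<le> a" "a > 0"
  shows "real a ^ r * exp (- (real r * (real r - 1) / (2 * real a)) - 2 * real r ^ 3 / real a ^ 2) \<le> ffall a r"
    and "real a ^ r * exp (- (real r ^ 2 / real a)) \<le> ffall a r"
proof -
  have ln_ge: "- y - 2 * y ^ 2 \<le> ln (1 - y)" "- (2 * y) \<le> ln (1 - y)" if "0 \<le> y" "y \<le> 1 / 2" for y :: real
  proof -
    show 1: "- y - 2 * y ^ 2 \<le> ln (1 - y)" using that by (rule ln_one_minus_pos_lower_bound)
    have "y * y \<le> y * (1 / 2)" using that by (intro mult_left_mono) auto
    then show "- (2 * y) \<le> ln (1 - y)" using 1 by (simp add: power2_eq_square)
  qed
  have ge: "real a ^ r * exp (\<Sum>i<r. f (real i / a)) \<le> ffall a r"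
    if f: "\<And>y. 0 \<le> y \<Longrightarrow> y \<le> 1 / 2 \<Longrightarrow> f y \<le> ln (1 - y)" for f :: "real \<Rightarrow> real"
  proof -
    have "real a ^ r * exp (\<Sum>i<r. f (real i / a)) = (\<Prod>i<r. real a * exp (f (real i / a)))"
      by (simp add: prod.distrib exp_sum)
    also have "\<dots> \<le> ffall a r"
      unfolding ffall_def
    proof (intro prod_mono conjI)
      fix i assume "i \<in> {..<r}"
      then have i: "0 \<le> real i / a" "real i / a \<le> 1 / 2" using assms by (auto simp: divide_simps)
      have "exp (f (real i / a)) \<le> exp (ln (1 - real i / a))" using f[OF i] by simp
      also have "\<dots> = 1 - real i / a" using i by (intro exp_ln) linarith
      finally have "real a * exp (f (real i / a)) \<le> real a * (1 - real i / a)" by (intro mult_left_mono) auto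
      then show "real a * exp (f (real i / a)) \<le> real a - real i" using assms by (simp add: right_diff_distrib)
    qed auto
    finally show ?thesis .
  qed
  have "- (real r * (real r - 1) / (2 * real a)) - 2 * real r ^ 3 / real a ^ 2
      \<le> (\<Sum>i<r. - (real i / a) - 2 * (real i / a) ^ 2)"
  proof -
    have "(\<Sum>i<r. (real i / a) ^ 2) \<le> (\<Sum>i<r. (real r / a) ^ 2)"
      by (intro sum_mono power_mono divide_right_mono) auto
    also have "\<dots> = real r ^ 3 / real a ^ 2" by (simp add: power_divide power2_eq_square power3_eq_cube)
    finally have "(\<Sum>i<r. (real i / a) ^ 2) \<le> real r ^ 3 / real a ^ 2" .
    moreover have "(\<Sum>i<r. real i / a) = real r * (real r - 1) / (2 * real a)"
      by (rule sum_lessThan_div)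
    moreover have "(\<Sum>i<r. - (real i / a) - 2 * (real i / a) ^ 2)
        = - (\<Sum>i<r. real i / a) - 2 * (\<Sum>i<r. (real i / a) ^ 2)"
      by (simp add: sum_subtractf sum_negf sum_distrib_left)
    ultimately show ?thesis by simp
  qed
  then have "real a ^ r * exp (- (real r * (real r - 1) / (2 * real a)) - 2 * real r ^ 3 / real a ^ 2)
      \<le> real a ^ r * exp (\<Sum>i<r. - (real i / a) - 2 * (real i / a) ^ 2)"
    by (intro mult_left_mono) auto
  also have "\<dots> \<le> ffall a r" by (rule ge[OF ln_ge(1)])
  finally show "real a ^ r * exp (- (real r * (real r - 1) / (2 * real a)) - 2 * real r ^ 3 / real a ^ 2) \<le> ffall a r" .
  have "- (real r ^ 2 / real a) \<le> (\<Sum>i<r. - (2 * (real i / a)))"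
  proof -
    have "(\<Sum>i<r. - (2 * (real i / a))) = - (2 * (\<Sum>i<r. real i / a))"
      by (simp add: sum_negf sum_distrib_left)
    also have "\<dots> = - (real r * (real r - 1) / a)" by (simp add: sum_lessThan_div)
    finally show ?thesis by (simp add: power2_eq_square divide_right_mono mult_left_mono)
  qed
  then have "real a ^ r * exp (- (real r ^ 2 / real a)) \<le> real a ^ r * exp (\<Sum>i<r. - (2 * (real i / a)))"
    by (intro mult_left_mono) auto
  also have "\<dots> \<le> ffall a r" by (rule ge[OF ln_ge(2)])
  finally show "real a ^ r * exp (- (real r ^ 2 / real a)) \<le> ffall a r" .
qed

lemma card_kgraphs: "card (kgraphs n k m) = (n choose k) choose m"
proof -
  have "finite {e. e \<subseteq> {1..n} \<and> card e = k}" by (rule finite_subset[of _ "Pow {1..n}"]) auto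
  then have "card (kgraphs n k m) = card {e. e \<subseteq> {1..n} \<and> card e = k} choose m"
    unfolding kgraphs_def by (rule n_subsets)
  also have "card {e. e \<subseteq> {1..n} \<and> card e = k} = n choose k"
    using n_subsets[of "{1..n}" k] by simp
  finally show ?thesis .
qed

section \<open>Comparison of the two distributions\<close>

context degree_list_small begin

lemma d_nonneg: "v \<in> {1..n} \<Longrightarrow> 0 \<le> d v"
  using count_xs by (metis of_nat_0_le_iff)

lemma sum_d: "(\<Sum>v\<in>{1..n}. nat (d v)) = m * k"
proof -
  have "(\<Sum>v\<in>{1..n}. nat (d v)) = (\<Sum>v\<in>{1..n}. count (mset xs) v)"
    using count_xs by (intro sum.cong refl) (metis nat_int)
  also have "\<dots> = (\<Sum>v\<in>set_mset (mset xs). count (mset xs) v)"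
    using set_xs by (intro sum.mono_neutral_right) (auto simp: count_mset_0_iff)
  also have "\<dots> = m * k" using len size_multiset_overloaded_eq[of "mset xs"] by simp
  finally show ?thesis .
qed

lemma mk_le: "m * k \<le> n * D"
proof -
  have "(\<Sum>v\<in>{1..n}. nat (d v)) \<le> (\<Sum>v\<in>{1..n}. D)" using d_le by (intro sum_mono) force
  then show ?thesis using sum_d by simp
qed

lemma sum_d_real: "(\<Sum>v\<in>{1..n}. real_of_int (d v)) = real (m * k)"
proof -
  have "(\<Sum>v\<in>{1..n}. real_of_int (d v)) = (\<Sum>v\<in>{1..n}. real (nat (d v)))"
    using d_nonneg by (intro sum.cong) auto
  also have "\<dots> = real (m * k)" unfolding sum_d[symmetric] by simp
  finally show ?thesis .
qed

text \<open>The exponent of the theorem splits into two contributions: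
  \<open>m k (k - 1) / (2 n)\<close> from \<open>n choose k\<close> against
  \<open>n ^ k / k!\<close>, and \<open>lam\<close> from the loops. The identity is the expansion of
  the variance around the mean degree.\<close>

lemma exponent_eq:
  assumes "n > 0"
  shows "(real k - 1) / 2 * (1 - real n * sigma2 n k m d / real (k * m))
    = real m * (real k * (real k - 1) / (2 * real n)) - lam"
proof -
  let ?S2 = "\<Sum>v\<in>{1..n}. real_of_int (d v) * (real_of_int (d v) - 1)"
  define a where "a = real (m * k) / real n"
  have pos: "real (m * k) > 0" using k m by simp
  have "(\<Sum>v\<in>{1..n}. (real_of_int (d v) - a) ^ 2)
      = (\<Sum>v\<in>{1..n}. real_of_int (d v) * (real_of_int (d v) - 1)
           + (1 - 2 * a) * real_of_int (d v) + a ^ 2)"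
    by (intro sum.cong) (auto simp: power2_eq_square algebra_simps)
  also have "\<dots> = ?S2 + (1 - 2 * a) * real (m * k) + real n * a ^ 2"
    by (simp only: sum.distrib sum_distrib_left[symmetric] sum_d_real) simp
  also have "real n * a ^ 2 = a * real (m * k)" using assms by (simp add: a_def power2_eq_square)
  also have "?S2 + (1 - 2 * a) * real (m * k) + a * real (m * k) = ?S2 + (1 - a) * real (m * k)"
    by (simp add: left_diff_distrib)
  finally have "real n * sigma2 n k m d = ?S2 + (1 - a) * real (m * k)"
    using assms unfolding sigma2_def a_def mult.commute[of k m] by simp
  then have "real n * sigma2 n k m d / real (k * m) = (?S2 + (1 - a) * real (m * k)) / real (m * k)"
    unfolding mult.commute[of k m] by simp
  also have "\<dots> = ?S2 / real (m * k) + 1 - a"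
    using pos by (simp only: add_divide_distrib nonzero_mult_div_cancel_right[OF less_imp_neq[OF pos, symmetric]])
  finally have "real n * sigma2 n k m d / real (k * m) = ?S2 / real (m * k) + 1 - a" .
  then have "(real k - 1) / 2 * (1 - real n * sigma2 n k m d / real (k * m))
      = (real k - 1) / 2 * a - (real k - 1) / 2 * (?S2 / real (m * k))"
    by (simp add: right_diff_distrib)
  also have "(real k - 1) / 2 * (?S2 / real (m * k)) = lam"
    using pos by (simp add: lam_def)
  also have "(real k - 1) / 2 * a = real m * (real k * (real k - 1) / (2 * real n))"
    by (simp add: a_def)
  finally show ?thesis .
qed

text \<open>By \<open>card_simple\<close> the factorials of the degrees cancel, and the ratio of the
  probabilities is that of \<open>simple\<close> times a quotient \<open>W\<close> of falling
  factorials. Only \<open>n choose k\<close> needs the precise estimate; the others are powers up to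
  a factor \<open>exp (- E)\<close>.\<close>

lemma prob_ratio:
  assumes n: "2 * k \<le> n" and N: "N = (n - 1) choose (k - 1)" "2 * D \<le> N" and D: "D \<ge> 1"
    and E: "real D * real (m * k) / real N \<le> E"
  shows "\<exists>W. prob_B n k m d > 0 \<and> prob_D n k m d = prob_B n k m d * (real (card simple) / fact (m * k) * W)
     \<and> exp (real m * (real k * (real k - 1) / (2 * real n)) - E) \<le> W
     \<and> W \<le> exp (real m * (real k * (real k - 1) / (2 * real n)) + 2 * real m * real k ^ 3 / real n ^ 2 + 2 * E)"
proof -
  define C where "C = n choose k"
  define \<delta> where "\<delta> v = nat (d v)" for v
  have d\<delta>: "d v = int (\<delta> v)" if "v \<in> {1..n}" for v using d_nonneg[OF that] by (simp add: \<delta>_def)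
  have \<delta>D: "\<delta> v \<le> D" if "v \<in> {1..n}" for v using d_le[OF that] by (simp add: \<delta>_def)
  have s\<delta>: "(\<Sum>v\<in>{1..n}. \<delta> v) = m * k" using sum_d by (simp add: \<delta>_def)
  have np: "n > 0" and Np: "N > 0" using n k N D by auto
  have kC: "k * C = n * N" using times_binomial_minus1_eq[of k n] k by (simp add: C_def N)
  have big: "2 * (m * k) \<le> n * N"
    using mk_le mult_left_mono[OF N(2), of n] by linarith
  have "k * (2 * m) \<le> k * C" using big kC by (simp add: mult_ac)
  then have Cm: "2 * m \<le> C" using k by simp
  then have Cp: "C > 0" using m by simp
  let ?e = "real k * (real k - 1) / (2 * real n)"
  define fB where "fB = ffall (n * N) (m * k)"
  define fC where "fC = ffall C m"
  define fN where "fN = (\<Prod>v\<in>{1..n}. ffall N (\<delta> v))"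
  define dd where "dd = (\<Prod>v\<in>{1..n}. fact (\<delta> v) :: real)"
  have fact_nk: "fact k * real C = ffall n k" using binomial_ffall[of n k] by (simp add: C_def mult.commute)
  \<comment> \<open>The errors of \<open>fB\<close> and, further below, of \<open>fC\<close> are at
    most that of the product over the degrees, as \<open>m * k \<le> n * D\<close> and
    \<open>k * C = n * N\<close>.\<close>
  have M_nN: "real (m * k) ^ 2 / real (n * N) \<le> E"
  proof -
    have "real (m * k) * real (m * k) \<le> real (n * D) * real (m * k)"
      using mk_le by (intro mult_right_mono) (auto simp only: of_nat_le_iff of_nat_0_le_iff)
    then have "real (m * k) ^ 2 / real (n * N) \<le> real (n * D) * real (m * k) / real (n * N)"
      by (intro divide_right_mono) (auto simp only: power2_eq_square of_nat_0_le_iff)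
    also have "\<dots> = real D * real (m * k) / real N" using np by simp
    finally show ?thesis using E by simp
  qed
  have m_C: "real m ^ 2 / real C \<le> E"
  proof -
    have "real k * real C = real n * real N" using kC by (metis of_nat_mult)
    then have "real m ^ 2 / real C = real m ^ 2 * real k / (real n * real N)"
      using k Cp np Np by (simp add: field_simps)
    also have "\<dots> \<le> real (m * k) ^ 2 / real (n * N)"
    proof -
      have "real m ^ 2 * real k * 1 \<le> real m ^ 2 * real k * real k"
        using k by (intro mult_left_mono) auto
      then have "real m ^ 2 * real k \<le> real (m * k) ^ 2" by (simp add: power2_eq_square mult_ac)
      then show ?thesis by (simp add: divide_right_mono)
    qed
    finally show ?thesis using M_nN by simp
  qed
  have fN_le: "fN \<le> real N ^ (m * k)"
  proof -
    have "fN \<le> (\<Prod>v\<in>{1..n}. real N ^ \<delta> v)"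
      unfolding fN_def
    proof (intro prod_mono conjI)
      fix v assume "v \<in> {1..n}"
      then have "\<delta> v \<le> N" using \<delta>D[of v] N by simp
      then show "ffall N (\<delta> v) \<le> real N ^ \<delta> v" "0 \<le> ffall N (\<delta> v)"
        by (simp_all add: ffall_le_power ffall_nonneg)
    qed
    then show ?thesis by (simp add: power_sum s\<delta>[symmetric])
  qed
  have fN_ge: "real N ^ (m * k) * exp (- E) \<le> fN"
  proof -
    have "(\<Sum>v\<in>{1..n}. real (\<delta> v) ^ 2) \<le> (\<Sum>v\<in>{1..n}. real D * real (\<delta> v))"
      using \<delta>D by (intro sum_mono) (auto simp: power2_eq_square intro!: mult_right_mono)
    also have "\<dots> = real D * real (m * k)" by (simp add: sum_distrib_left[symmetric] flip: s\<delta>)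
    finally have "(\<Sum>v\<in>{1..n}. real (\<delta> v) ^ 2) / real N \<le> real D * real (m * k) / real N"
      by (intro divide_right_mono) auto
    then have "(\<Sum>v\<in>{1..n}. real (\<delta> v) ^ 2 / real N) \<le> E"
      using E by (simp add: sum_divide_distrib)
    then have "real N ^ (m * k) * exp (- E)
        \<le> real N ^ (m * k) * exp (\<Sum>v\<in>{1..n}. - (real (\<delta> v) ^ 2 / real N))"
      by (intro mult_left_mono) (auto simp: sum_negf)
    also have "\<dots> = (\<Prod>v\<in>{1..n}. real N ^ \<delta> v * exp (- (real (\<delta> v) ^ 2 / real N)))"
      by (simp add: prod.distrib exp_sum power_sum s\<delta>[symmetric])
    also have "\<dots> \<le> fN"
      unfolding fN_def
    proof (intro prod_mono conjI)
      fix v assume "v \<in> {1..n}"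
      then have "2 * \<delta> v \<le> N" using \<delta>D[of v] N by simp
      then show "real N ^ \<delta> v * exp (- (real (\<delta> v) ^ 2 / real N)) \<le> ffall N (\<delta> v)"
        using Np by (intro ffall_ge(2)) auto
    qed simp
    finally show ?thesis .
  qed
  have fC_le: "fC \<le> real C ^ m" unfolding fC_def using Cm by (intro ffall_le_power) simp
  have fC_ge: "real C ^ m * exp (- E) \<le> fC"
  proof -
    have "real C ^ m * exp (- E) \<le> real C ^ m * exp (- (real m ^ 2 / real C))"
      using m_C by (intro mult_left_mono) auto
    also have "\<dots> \<le> fC" unfolding fC_def using Cm Cp by (intro ffall_ge(2))
    finally show ?thesis .
  qed
  have fB_le: "fB \<le> real (n * N) ^ (m * k)" unfolding fB_def using big by (intro ffall_le_power) linarith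
  have fB_ge: "real (n * N) ^ (m * k) * exp (- E) \<le> fB"
  proof -
    have "real (n * N) ^ (m * k) * exp (- E) \<le> real (n * N) ^ (m * k) * exp (- (real (m * k) ^ 2 / real (n * N)))"
      using M_nN by (intro mult_left_mono) auto
    also have "\<dots> \<le> fB" unfolding fB_def using big np Np by (intro ffall_ge(2)) auto
    finally show ?thesis .
  qed
  have pos: "fN > 0" "fC > 0" "fB > 0" "dd > 0"
  proof -
    show "fN > 0" using fN_ge Np by (intro less_le_trans[OF _ fN_ge]) simp
    show "fC > 0" using Cp by (intro less_le_trans[OF _ fC_ge]) simp
    show "fB > 0" using np Np by (intro less_le_trans[OF _ fB_ge]) simp
    show "dd > 0" by (simp add: dd_def prod_pos)
  qed
  define W where "W = fB / (fact k ^ m * fC * fN)"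
  have pB: "prob_B n k m d = fN / dd * (fact (m * k) / fB)"
  proof -
    have "ibinom N (d v) = N choose \<delta> v" if "v \<in> {1..n}" for v
      using d\<delta>[OF that] by (simp add: ibinom_def)
    then have "prob_B n k m d = (\<Prod>v\<in>{1..n}. real (N choose \<delta> v)) / real ((n * N) choose (m * k))"
      by (simp add: prob_B_def Let_def N(1) mult.commute)
    also have "(\<Prod>v\<in>{1..n}. real (N choose \<delta> v)) = (\<Prod>v\<in>{1..n}. ffall N (\<delta> v) / fact (\<delta> v))"
      by (intro prod.cong) (auto simp: binomial_ffall[symmetric])
    also have "\<dots> = fN / dd" by (simp add: fN_def dd_def prod_dividef)
    also have "real ((n * N) choose (m * k)) = fB / fact (m * k)"
      using binomial_ffall[of "n * N" "m * k"] by (simp add: fB_def field_simps)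
    finally show ?thesis by simp
  qed
  have pD: "prob_D n k m d = real (card simple) / (fact k ^ m * dd * fC)"
  proof -
    have "real (card simple) = real (card H) * fact m * fact k ^ m * dd"
      using arg_cong[OF card_simple, of real] by (simp add: dd_def \<delta>_def)
    moreover have "prob_D n k m d = real (card H) / real (C choose m)"
      by (simp add: prob_D_def H_def card_kgraphs C_def)
    moreover have "real (C choose m) = fC / fact m"
      using binomial_ffall[of C m] by (simp add: fC_def field_simps)
    ultimately show ?thesis using pos by (simp add: field_simps)
  qed
  have "prob_B n k m d > 0" unfolding pB using pos by simp
  moreover have "prob_D n k m d = prob_B n k m d * (real (card simple) / fact (m * k) * W)"
    unfolding pB pD W_def using pos by (simp add: field_simps)
  \<comment> \<open>For this bound only \<open>fB\<close> is estimated from below with error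
    \<open>E\<close>, which costs one \<open>E\<close>; the upper bound on \<open>W\<close>
    estimates both \<open>fC\<close> and \<open>fN\<close> from below and costs two.\<close>
  moreover have "exp (real m * ?e - E) \<le> W"
  proof -
    have "fact k ^ m * fC * fN \<le> fact k ^ m * real C ^ m * real N ^ (m * k)"
      using pos fC_le fN_le by (intro mult_mono) auto
    also have "\<dots> = ffall n k ^ m * real N ^ (m * k)"
      by (simp add: fact_nk[symmetric] power_mult_distrib)
    also have "\<dots> \<le> (real n ^ k * exp (- ?e)) ^ m * real N ^ (m * k)"
      using n np ffall_nonneg[of k n] by (intro mult_right_mono power_mono ffall_le) auto
    also have "\<dots> = real (n * N) ^ (m * k) * exp (- (real m * ?e))"
      by (simp add: power_mult_distrib power_mult[symmetric] mult.commute[of k m] exp_of_nat_mult[symmetric])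
    finally have den: "fact k ^ m * fC * fN \<le> real (n * N) ^ (m * k) * exp (- (real m * ?e))" .
    have "exp (real m * ?e - E) * (fact k ^ m * fC * fN)
        \<le> exp (real m * ?e - E) * (real (n * N) ^ (m * k) * exp (- (real m * ?e)))"
      by (intro mult_left_mono den) auto
    also have "\<dots> = real (n * N) ^ (m * k) * exp (- E)"
      by (simp add: exp_diff exp_minus field_simps)
    also have "\<dots> \<le> fB" by (rule fB_ge)
    finally show ?thesis unfolding W_def using pos by (simp add: pos_le_divide_eq)
  qed
  moreover have "W \<le> exp (real m * ?e + 2 * real m * real k ^ 3 / real n ^ 2 + 2 * E)"
  proof -
    let ?g = "?e + 2 * real k ^ 3 / real n ^ 2"
    have "(real n ^ k * exp (- g)) ^ m = real n ^ (m * k) * exp (- (real m * g))" for g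
      by (simp add: power_mult_distrib power_mult[symmetric] mult.commute[of k m] exp_of_nat_mult[symmetric])
    note pw = this
    have g: "- ?e - 2 * real k ^ 3 / real n ^ 2 = - ?g" by linarith
    have "exp (- (real m * ?g) - 2 * E) = exp (- (real m * ?g)) * (exp (- E) * exp (- E))"
      by (simp only: exp_add[symmetric]) (rule arg_cong[where f = exp], simp)
    then have "real (n * N) ^ (m * k) * exp (- (real m * ?g) - 2 * E)
        = real n ^ (m * k) * exp (- (real m * ?g)) * exp (- E) * (real N ^ (m * k) * exp (- E))"
      by (simp only: of_nat_mult power_mult_distrib mult_ac)
    also have "\<dots> = (real n ^ k * exp (- ?e - 2 * real k ^ 3 / real n ^ 2)) ^ m * exp (- E) * (real N ^ (m * k) * exp (- E))"
      unfolding g pw ..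
    also have "\<dots> \<le> ffall n k ^ m * exp (- E) * fN"
      using n np ffall_nonneg[of k n] by (intro mult_mono power_mono ffall_ge fN_ge) auto
    also have "ffall n k ^ m * exp (- E) = fact k ^ m * (real C ^ m * exp (- E))"
      by (simp add: fact_nk[symmetric] power_mult_distrib)
    also have "\<dots> * fN \<le> fact k ^ m * fC * fN"
      using pos fC_ge by (intro mult_right_mono mult_left_mono) auto
    finally have den: "real (n * N) ^ (m * k) * exp (- (real m * ?g) - 2 * E) \<le> fact k ^ m * fC * fN" .
    have "fB \<le> exp (real m * ?g + 2 * E) * (real (n * N) ^ (m * k) * exp (- (real m * ?g) - 2 * E))"
      using fB_le by (simp add: exp_diff exp_add exp_minus field_simps)
    also have "\<dots> \<le> exp (real m * ?g + 2 * E) * (fact k ^ m * fC * fN)"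
      by (intro mult_left_mono den) auto
    finally have "W \<le> exp (real m * ?g + 2 * E)" unfolding W_def using pos by (simp add: pos_divide_le_eq)
    also have "real m * ?g + 2 * E = real m * ?e + 2 * real m * real k ^ 3 / real n ^ 2 + 2 * E"
      by (simp add: distrib_left)
    finally show ?thesis .
  qed
  ultimately show ?thesis by blast
qed

end

text \<open>The term \<open>ln n ^ 9\<close> makes \<open>m\<close> at least \<open>10 ^ 6\<close>;
  together with \<open>D ^ 2 \<le> m\<close> this will yield \<open>1000 * D \<le> m\<close>. The
  factor \<open>3\<close> in the fourth claim is the value of \<open>k\<close> in the case
  \<open>k = 3\<close>.\<close>

lemma psi_facts:
  assumes k: "k \<ge> 3" and m: "m > 0" and D: "D > 0" and \<psi>: "psi n k D m < 1" and ln: "ln (real n) \<ge> 5"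
  shows "0 < psi n k D m" and "real m \<ge> 1000000" and "real D ^ 2 \<le> real m"
    and "real k * real D ^ 2 / real m \<le> 3 * psi n k D m"
    and "k = 3 \<Longrightarrow> real D ^ 3 / real m \<le> psi n k D m"
    and "k \<ge> 4 \<Longrightarrow> real k ^ 2 * real D ^ 2 / real m \<le> psi n k D m"
proof -
  have l9: "ln (real n) ^ 9 \<ge> 1000000"
  proof -
    have "(1000000 :: real) \<le> 5 ^ 9" by simp
    also have "\<dots> \<le> ln (real n) ^ 9" using ln by (intro power_mono) auto
    finally show ?thesis .
  qed
  have D1: "real D \<ge> 1" and mp: "real m > 0" using D m by auto
  have "0 < psi n k D m \<and> real m \<ge> 1000000 \<and> real D ^ 2 \<le> real m \<and>
     real k * real D ^ 2 / real m \<le> 3 * psi n k D m \<and> (k = 3 \<longrightarrow> real D ^ 3 / real m \<le> psi n k D m) \<and>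
     (k \<ge> 4 \<longrightarrow> real k ^ 2 * real D ^ 2 / real m \<le> psi n k D m)"
  proof (cases "k = 3")
    case True
    then have \<psi>eq: "psi n k D m = (real D ^ 3 + ln (real n) ^ 9) / real m" by (simp add: psi_def)
    have "real D ^ 2 \<le> real D ^ 3" using D1 by (intro power_increasing) auto
    moreover have "real D ^ 3 + ln (real n) ^ 9 < real m" using \<psi> mp by (simp add: \<psi>eq)
    moreover have "real D ^ 3 \<ge> 0" by simp
    moreover have "real D ^ 3 / real m \<le> psi n k D m"
      unfolding \<psi>eq using ln by (intro divide_right_mono) auto
    moreover have "3 * real D ^ 2 / real m \<le> 3 * (real D ^ 3 / real m)"
      using \<open>real D ^ 2 \<le> real D ^ 3\<close> by (simp add: divide_right_mono)
    moreover have "0 < psi n k D m" unfolding \<psi>eq using ln D1 mp by (intro divide_pos_pos add_nonneg_pos) auto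
    moreover from calculation have "real m \<ge> 1000000" "real D ^ 2 \<le> real m"
      using l9 zero_le_power[of "ln (real n)" 9] ln by linarith+
    ultimately show ?thesis using True by simp
  next
    case False
    then have k4: "real k \<ge> 4" using k by simp
    define Y where "Y = real D ^ 2 + real k * real D * ln (real n) ^ 4 + real k ^ 2 * ln (real n) ^ 9"
    have \<psi>eq: "psi n k D m = real k ^ 2 * Y / real m" using False by (simp add: psi_def Y_def)
    have nn: "real k * real D * ln (real n) ^ 4 \<ge> 0" using ln by simp
    have "1 * ln (real n) ^ 9 \<le> real k ^ 2 * ln (real n) ^ 9"
      using k4 ln by (intro mult_right_mono one_le_power) auto
    then have Y: "Y \<ge> real D ^ 2 + 1000000" unfolding Y_def using nn l9 by linarith
    have Yp: "Y > 0" using Y zero_le_power2[of "real D"] by linarith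
    have "1 * Y \<le> real k ^ 2 * Y" using k4 Yp by (intro mult_right_mono one_le_power) auto
    moreover have "real k ^ 2 * Y < real m" using \<psi> mp by (simp add: \<psi>eq)
    ultimately have Ym: "Y < real m" by linarith
    have "0 < psi n k D m" unfolding \<psi>eq using k4 Yp mp by simp
    moreover have 4: "real k ^ 2 * real D ^ 2 / real m \<le> psi n k D m"
      unfolding \<psi>eq using Y by (intro divide_right_mono mult_left_mono) auto
    moreover have "real k * real D ^ 2 / real m \<le> real k ^ 2 * real D ^ 2 / real m"
      using k4 by (intro divide_right_mono mult_right_mono) (auto simp: power2_eq_square)
    moreover have "real m \<ge> 1000000" "real D ^ 2 \<le> real m"
      using Y Ym zero_le_power2[of "real D"] by linarith+
    ultimately show ?thesis using False by auto
  qed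
  then show "0 < psi n k D m" "real m \<ge> 1000000" "real D ^ 2 \<le> real m"
    "real k * real D ^ 2 / real m \<le> 3 * psi n k D m"
    "k = 3 \<Longrightarrow> real D ^ 3 / real m \<le> psi n k D m"
    "k \<ge> 4 \<Longrightarrow> real k ^ 2 * real D ^ 2 / real m \<le> psi n k D m" by blast+
qed

section \<open>The final estimate\<close>

lemma count_concat_replicate:
  "distinct vs \<Longrightarrow> count (mset (concat (map (\<lambda>v. replicate (f v) v) vs))) v = (if v \<in> set vs then f v else 0)"
  by (induction vs) auto

lemma length_concat_replicate:
  "length (concat (map (\<lambda>v. replicate (f v) v) vs)) = sum_list (map f vs)"
  by (induction vs) auto

lemma exp_minus_one_le: "exp z - 1 \<le> z * exp z" for z :: real
proof -
  have "(1 + - z) * exp z \<le> exp (- z) * exp z" by (intro mult_right_mono exp_ge_add_one_self) auto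
  then show ?thesis by (simp add: exp_minus algebra_simps)
qed

context degree_list_small begin

text \<open>The ratio of the two sides is \<open>P * W * exp (- X)\<close>, which lies between
  \<open>1 - 93 * p\<close> and \<open>exp (48 * p)\<close>. The error is thus of order
  \<open>p\<close>, and \<open>p \<le> sqrt p\<close> as \<open>p < 1\<close>.\<close>

lemma prob_asymp:
  assumes k3: "k \<ge> 3" and D: "D > 0" and \<psi>: "psi n k D m < 1" and ln: "ln (real n) \<ge> 5"
  shows "\<exists>\<epsilon>. \<bar>\<epsilon>\<bar> \<le> 94 * exp 48 * sqrt (psi n k D m) \<and>
        prob_D n k m d = prob_B n k m d
          * exp ((real k - 1) / 2 * (1 - real n * sigma2 n k m d / real (k * m))) * (1 + \<epsilon>)"
proof -
  define p where "p = psi n k D m"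
  have mp: "m > 0" using m by simp
  note f = psi_facts[OF k3 mp D \<psi> ln, folded p_def]
  have p: "0 < p" "p < 1" using f(1) \<psi> by (auto simp: p_def)
  have pp: "p ^ 2 \<le> p" using p by (simp add: power2_eq_square mult_left_le)
  have rm: "real m > 0" and rk: "real k \<ge> 3" and rD: "real D \<ge> 1" using mp k3 D by auto
  have "1000 * (k * D) \<le> n * D" using kD mk_le by linarith
  then have nk: "1000 * k \<le> n" using D by (simp add: mult.assoc[symmetric])
  then have np: "n > 0" using k by linarith
  have mk_le': "real m * real k \<le> real n * real D" using mk_le by (metis of_nat_le_iff of_nat_mult)
  \<comment> \<open>\<open>a\<close> is at most \<open>n / k\<close> because
    \<open>m * k \<le> n * D\<close>, and at least \<open>D\<close> because
    \<open>D ^ 2 \<le> m\<close>; its powers bound the binomial coefficient \<open>N\<close> from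
    below.\<close>
  define a where "a = real m / real D"
  have a: "a \<le> real n / real k" using mk_le' rk rD by (simp add: a_def field_simps)
  have "1000 * D \<le> m" using kD k by (simp add: mult.commute)
  then have "real (1000 * D) \<le> real m" by (simp only: of_nat_le_iff)
  then have a1000: "a \<ge> 1000" using rD by (simp add: a_def field_simps)
  have aD: "a \<ge> real D" using f(3) rD by (simp add: a_def field_simps power2_eq_square)
  define N where "N = (n - 1) choose (k - 1)"
  have N_ge: "a ^ (k - 1) \<le> real N"
  proof -
    have "real n / real k \<le> real (n - 1) / real (k - 1)"
    proof -
      have "real n * (real k - 1) \<le> (real n - 1) * real k" using nk by (simp add: algebra_simps)
      then show ?thesis using nk np k3 by (simp add: field_simps of_nat_diff)
    qed
    with a have "a \<le> real (n - 1) / real (k - 1)" by (rule order_trans)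
    then have "a ^ (k - 1) \<le> (real (n - 1) / real (k - 1)) ^ (k - 1)"
      using a1000 by (intro power_mono) auto
    also have "\<dots> \<le> real N" unfolding N_def using nk by (intro binomial_ge_n_over_k_pow_k) auto
    finally show ?thesis .
  qed
  have N2: "2 * D \<le> N"
  proof -
    have "2 * real D \<le> a * a" using a1000 aD rD by (intro mult_mono) auto
    also have "\<dots> \<le> a ^ (k - 1)"
      using a1000 k3 power_increasing[of 2 "k - 1" a] by (simp add: power2_eq_square)
    finally show ?thesis using N_ge by linarith
  qed
  have Np: "0 < real N" using N2 D by simp
  \<comment> \<open>For \<open>k = 3\<close> the bound \<open>N \<ge> a ^ 2\<close> gives the term
    \<open>D ^ 3 / m\<close>; for \<open>k \<ge> 4\<close> the bound \<open>N \<ge> a ^ 3\<close>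
    even gives \<open>p ^ 2\<close>.\<close>
  have E: "real D * real (m * k) / real N \<le> 3 * p"
  proof (cases "k = 3")
    case True
    have "real D * real (m * k) / real N \<le> real D * real (m * k) / a ^ 2"
      using N_ge a1000 Np True by (intro divide_left_mono mult_pos_pos) auto
    also have "\<dots> = 3 * (real D ^ 3 / real m)"
      using rm rD by (simp add: a_def True field_simps power2_eq_square power3_eq_cube)
    also have "\<dots> \<le> 3 * p" using f(5)[OF True] by simp
    finally show ?thesis .
  next
    case False
    then have k4: "k \<ge> 4" using k3 by simp
    have "a ^ 3 \<le> a ^ (k - 1)" using a1000 k4 by (intro power_increasing) auto
    with N_ge have "a ^ 3 \<le> real N" by linarith
    then have "real D * real (m * k) / real N \<le> real D * real (m * k) / a ^ 3"
      using a1000 Np by (intro divide_left_mono mult_pos_pos) auto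
    also have "\<dots> = real k * (real D ^ 2 / real m) ^ 2"
      using rm rD by (simp add: a_def field_simps power2_eq_square power3_eq_cube)
    also have "\<dots> \<le> real k ^ 4 * (real D ^ 2 / real m) ^ 2"
      using rk power_increasing[of 1 4 "real k"] by (intro mult_right_mono) auto
    also have "\<dots> = (real k ^ 2 * real D ^ 2 / real m) ^ 2"
      by (simp add: power_mult_distrib power_divide)
    also have "\<dots> \<le> p ^ 2" using f(6)[OF k4] by (intro power_mono) auto
    finally show ?thesis using pp p by simp
  qed
  obtain W where W: "prob_B n k m d > 0"
      "prob_D n k m d = prob_B n k m d * (real (card simple) / fact (m * k) * W)"
      "exp (real m * (real k * (real k - 1) / (2 * real n)) - 3 * p) \<le> W"
      "W \<le> exp (real m * (real k * (real k - 1) / (2 * real n)) + 2 * real m * real k ^ 3 / real n ^ 2 + 2 * (3 * p))"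
    using prob_ratio[OF _ N_def N2 _ E] nk D by auto
  define A where "A = real m * (real k * (real k - 1) / (2 * real n))"
  define X where "X = (real k - 1) / 2 * (1 - real n * sigma2 n k m d / real (k * m))"
  have X: "X = A - lam" using exponent_eq[OF np] by (simp add: X_def A_def)
  define P where "P = real (card simple) / fact (m * k)"
  have P0: "P \<ge> 0" by (simp add: P_def)
  have W0: "W > 0" using W(3) by (rule less_le_trans[rotated]) simp
  have th: "2 * real m * real k ^ 3 / real n ^ 2 \<le> 6 * p"
  proof -
    have "(a * real k) ^ 2 \<le> real n ^ 2"
      using a a1000 rk by (intro power_mono) (auto simp: field_simps)
    then have "2 * real m * real k ^ 3 / real n ^ 2 \<le> 2 * real m * real k ^ 3 / (a * real k) ^ 2"
      using a1000 rk np by (intro divide_left_mono) auto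
    also have "\<dots> = 2 * (real k * real D ^ 2 / real m)"
      using rm rD rk by (simp add: a_def field_simps power2_eq_square power3_eq_cube)
    finally show ?thesis using f(4) by linarith
  qed
  have P_le: "P \<le> exp (- lam + 36 * p)"
  proof -
    have "P \<le> exp (- lam + 12 * (real k * real D ^ 2 / real m))"
      unfolding P_def using card_simple_upper by (simp add: pos_divide_le_eq)
    also have "\<dots> \<le> exp (- lam + 36 * p)" using f(4) by simp
    finally show ?thesis .
  qed
  \<comment> \<open>\<open>48 = 36 + 12\<close>: the loops contribute \<open>36 * p\<close>, and
    \<open>W\<close> contributes \<open>6 * p\<close> from \<open>th\<close> and
    \<open>2 * (3 * p)\<close> from \<open>E\<close>.\<close>
  have upper: "P * W * exp (- X) \<le> exp (48 * p)"
  proof -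
    have "W \<le> exp (A + 12 * p)"
      by (rule order_trans[OF W(4)]) (use th in \<open>simp add: A_def\<close>)
    then have "P * W \<le> exp (- lam + 36 * p) * exp (A + 12 * p)"
      using P_le P0 W0 by (intro mult_mono) auto
    then have "P * W * exp (- X) \<le> exp (- lam + 36 * p) * exp (A + 12 * p) * exp (- X)"
      by (intro mult_right_mono) auto
    also have "\<dots> = exp (48 * p)"
      unfolding X by (simp only: exp_add[symmetric]) (rule arg_cong[where f = exp], simp)
    finally show ?thesis .
  qed
  \<comment> \<open>\<open>93 = 54 + 36 + 3\<close>, from repeated edges, loops and
    \<open>W\<close>. For \<open>54 * p > 1\<close> the left-hand side is negative.\<close>
  have lower: "1 - 93 * p \<le> P * W * exp (- X)"
  proof (cases "54 * p \<le> 1")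
    case False
    have "0 \<le> P * W * exp (- X)" using P0 W0 by simp
    then show ?thesis using False p by linarith
  next
    case True
    \<comment> \<open>Three common vertices are all that an edge has for \<open>k = 3\<close>. For
      \<open>k \<ge> 4\<close> three would give a bound of order \<open>k ^ 3 * D ^ 3 / m\<close>,
      which \<open>p\<close> does not control, whereas four give
      \<open>2 * (k ^ 2 * D ^ 2 / m) ^ 2\<close>.\<close>
    define r where "r = (if k = 3 then 3 else 4 :: nat)"
    have \<beta>: "2 * (real (m * k) * real k ^ (r - 1)) ^ 2 * (real (m * k) * real D) ^ r / real (m * k) ^ (2 * r) \<le> 54 * p"
    proof (cases "k = 3")
      case True
      have "2 * (real (m * k) * real k ^ (r - 1)) ^ 2 * (real (m * k) * real D) ^ r / real (m * k) ^ (2 * r)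
          = 54 * (real D ^ 3 / real m)"
        using rm by (simp add: r_def True field_simps eval_nat_numeral)
      then show ?thesis using f(5)[OF True] by simp
    next
      case False
      then have k4: "k \<ge> 4" using k3 by simp
      have "2 * (real (m * k) * real k ^ (r - 1)) ^ 2 * (real (m * k) * real D) ^ r / real (m * k) ^ (2 * r)
          = 2 * (real k ^ 2 * real D ^ 2 / real m) ^ 2"
        using rm rk False by (simp add: r_def field_simps eval_nat_numeral)
      also have "\<dots> \<le> 2 * p ^ 2" using f(6)[OF k4] by (intro mult_left_mono power_mono) auto
      finally show ?thesis using pp p by linarith
    qed
    have "(1 - 54 * p) * (exp (- lam - 12 * (real k * real D ^ 2 / real m)) * fact (m * k)) \<le> card simple"
      by (rule card_simple_lower[of r]) (use \<beta> True k3 in \<open>auto simp: r_def\<close>)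
    then have "(1 - 54 * p) * exp (- lam - 12 * (real k * real D ^ 2 / real m)) \<le> P"
      by (simp add: P_def pos_le_divide_eq mult.assoc)
    moreover have "(1 - 54 * p) * exp (- lam - 36 * p) \<le> (1 - 54 * p) * exp (- lam - 12 * (real k * real D ^ 2 / real m))"
      using True f(4) by (intro mult_left_mono) auto
    ultimately have "(1 - 54 * p) * exp (- lam - 36 * p) \<le> P" by linarith
    then have "(1 - 54 * p) * exp (- lam - 36 * p) * exp (A - 3 * p) \<le> P * W"
      using W(3) P0 by (intro mult_mono) (auto simp: A_def)
    then have "(1 - 54 * p) * exp (- lam - 36 * p) * exp (A - 3 * p) * exp (- X) \<le> P * W * exp (- X)"
      by (intro mult_right_mono) auto
    moreover have "exp (- lam - 36 * p) * exp (A - 3 * p) * exp (- X) = exp (- (39 * p))"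
      unfolding X by (simp only: exp_add[symmetric]) (rule arg_cong[where f = exp], simp)
    ultimately have "(1 - 54 * p) * exp (- (39 * p)) \<le> P * W * exp (- X)"
      by (simp only: mult.assoc)
    moreover have "(1 - 54 * p) * (1 + - (39 * p)) \<le> (1 - 54 * p) * exp (- (39 * p))"
      using True by (intro mult_left_mono exp_ge_add_one_self) auto
    moreover have "1 - 93 * p \<le> (1 - 54 * p) * (1 + - (39 * p))"
      using p by (simp add: algebra_simps)
    ultimately show ?thesis by linarith
  qed
  define \<epsilon> where "\<epsilon> = P * W * exp (- X) - 1"
  have e48: "exp 48 \<ge> (1 :: real)" by simp
  have "\<epsilon> \<le> 48 * p * exp 48"
  proof -
    have "\<epsilon> \<le> exp (48 * p) - 1" using upper by (simp add: \<epsilon>_def)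
    also have "\<dots> \<le> 48 * p * exp (48 * p)" by (rule exp_minus_one_le)
    also have "\<dots> \<le> 48 * p * exp 48" using p by (intro mult_left_mono) auto
    finally show ?thesis .
  qed
  moreover have "48 * p * exp 48 \<le> 94 * exp 48 * p" using p by simp
  moreover have "93 * p * 1 \<le> 94 * p * exp 48" using p e48 by (intro mult_mono) auto
  moreover have "- (93 * p) \<le> \<epsilon>" using lower by (simp add: \<epsilon>_def)
  ultimately have "\<bar>\<epsilon>\<bar> \<le> 94 * exp 48 * p" by (simp add: abs_le_iff mult_ac)
  also have "\<dots> \<le> 94 * exp 48 * sqrt p"
    using pp by (intro mult_left_mono real_le_rsqrt) auto
  finally have "\<bar>\<epsilon>\<bar> \<le> 94 * exp 48 * sqrt p" .
  moreover have "prob_D n k m d = prob_B n k m d * exp X * (1 + \<epsilon>)"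
    using W(2) by (simp add: \<epsilon>_def P_def exp_minus field_simps)
  ultimately show ?thesis unfolding p_def X_def by blast
qed

end

lemma prob_zero_of_negative:
  assumes "v \<in> {1..n}" "d v < 0"
  shows "prob_D n k m d = 0" and "prob_B n k m d = 0"
proof -
  have "\<not> has_degseq n E d" for E
  proof
    assume "has_degseq n E d"
    then have "int (deg E v) = d v" using assms(1) by (simp add: has_degseq_def)
    then show False using assms(2) by simp
  qed
  then show "prob_D n k m d = 0" by (simp add: prob_D_def)
  have "(\<Prod>v\<in>{1..n}. real (ibinom ((n - 1) choose (k - 1)) (d v))) = 0"
    using assms by (intro prod_zero) (auto simp: ibinom_def)
  then show "prob_B n k m d = 0" by (simp add: prob_B_def Let_def)
qed

text \<open>Uniformity lies in the order of the quantifiers: \<open>C\<close> and \<open>n0\<close>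
  precede all parameters. The threshold makes \<open>ln n\<close> at least \<open>5\<close>.\<close>

theorem theorem1p3:
  "\<exists>C n0. \<forall>n \<ge> n0. \<forall>k m Ds. \<forall>d :: nat \<Rightarrow> int.
     k \<ge> 3 \<and> m > 0 \<and> Ds > 0 \<and> psi n k Ds m < 1 \<and>
     (\<Sum>v\<in>{1..n}. d v) = int (k * m) \<and> maxdeg n d \<le> int Ds \<longrightarrow>
     (\<exists>\<epsilon>. \<bar>\<epsilon>\<bar> \<le> C * sqrt (psi n k Ds m) \<and>
        prob_D n k m d =
          prob_B n k m d
          * exp ((real k - 1) / 2 * (1 - real n * sigma2 n k m d / real (k * m)))
          * (1 + \<epsilon>))"
proof (rule exI[of _ "94 * exp 48"], rule exI[of _ "nat \<lceil>exp 5 :: real\<rceil>"], intro allI impI, elim conjE)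
  fix n k m Ds :: nat and d :: "nat \<Rightarrow> int"
  assume n: "nat \<lceil>exp 5 :: real\<rceil> \<le> n" and k3: "k \<ge> 3" and m0: "m > 0" and Ds: "Ds > 0"
    and \<psi>: "psi n k Ds m < 1" and sum: "(\<Sum>v\<in>{1..n}. d v) = int (k * m)" and max: "maxdeg n d \<le> int Ds"
  have "exp 5 \<le> real n" using n by linarith
  moreover from this have "0 < real n" by (rule less_le_trans[OF exp_gt_zero])
  ultimately have ln: "5 \<le> ln (real n)" using ln_ge_iff by blast
  note f = psi_facts[OF k3 m0 Ds \<psi> ln]
  show "\<exists>\<epsilon>. \<bar>\<epsilon>\<bar> \<le> 94 * exp 48 * sqrt (psi n k Ds m) \<and> prob_D n k m d = prob_B n k m d
          * exp ((real k - 1) / 2 * (1 - real n * sigma2 n k m d / real (k * m))) * (1 + \<epsilon>)"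
  proof (cases "\<forall>v\<in>{1..n}. 0 \<le> d v")
    case False
    then obtain v where "v \<in> {1..n}" "d v < 0" by force
    note z = prob_zero_of_negative[of v n d, OF this]
    \<comment> \<open>Both probabilities vanish, so \<open>\<epsilon> = 0\<close> serves.\<close>
    show ?thesis using f(1) by (intro exI[of _ 0]) (simp add: z)
  next
    case True
    define xs where "xs = concat (map (\<lambda>v. replicate (nat (d v)) v) [1..<Suc n])"
    \<comment> \<open>\<open>10 ^ 6 \<le> m\<close> and \<open>Ds ^ 2 \<le> m\<close> multiply to
      \<open>(1000 * Ds) ^ 2 \<le> m ^ 2\<close>.\<close>
    have "real (1000 * Ds) ^ 2 \<le> real m ^ 2"
    proof -
      have "1000000 * real Ds ^ 2 \<le> real m * real m" using f(2,3) by (intro mult_mono) auto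
      then show ?thesis by (simp add: power2_eq_square)
    qed
    then have "real (1000 * Ds) \<le> real m" by (rule power2_le_imp_le) simp
    then have Dm: "1000 * Ds \<le> m" by (simp only: of_nat_le_iff)
    interpret degree_list_small n k m d xs Ds
    proof
      show "set xs \<subseteq> {1..n}" by (auto simp: xs_def)
      have "length xs = (\<Sum>v\<leftarrow>[1..<Suc n]. nat (d v))"
        unfolding xs_def by (rule length_concat_replicate)
      also have "\<dots> = (\<Sum>v\<in>{1..n}. nat (d v))"
        by (simp only: sum_list_distinct_conv_sum_set[OF distinct_upt] set_upt atLeastLessThanSuc_atLeastAtMost)
      also have "int \<dots> = int (m * k)" using True sum by (simp add: mult.commute)
      finally show "length xs = m * k" by linarith
      show "int (count (mset xs) v) = d v" if "v \<in> {1..n}" for v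
        unfolding xs_def using that True by (subst count_concat_replicate) auto
      show "d v \<le> int Ds" if "v \<in> {1..n}" for v
      proof -
        have "d v \<le> maxdeg n d" unfolding maxdeg_def using that by (intro Max_ge) auto
        then show ?thesis using max by simp
      qed
      show "1000 * (k * Ds) \<le> m * k" using mult_right_mono[OF Dm, of k] by (simp add: mult_ac)
    qed (use k3 m0 in auto)
    show ?thesis by (rule prob_asymp[OF k3 Ds \<psi> ln])
  qed
qed

end
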